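(* Let $X$ be a Banach space, $A:D(A)\subset X\to X$ a closed linear operator, $B\in\mathcal{B}(X)$, $r_1,\dots,r_n\ge0$, and $1\le p<\infty$. Suppose that for every $f\in L^p(\mathbb{T};X)$ there exists a unique $2\pi$-periodic strong $L^p$-solution of $$\frac{d}{dt}x(t)=Ax(t)+\sum_{j=1}^n Bx(t-r_j)+f(t),\qquad x(0)=x(2\pi).\tag{E}$$ Then (1) for every $k\in\mathbb{Z}$ the operator $\Delta_k=ikI-A-\sum_{j=1}^nB_{j,k}$ has a bounded inverse, and (2) the family $\{ik\Delta_k^{-1}\}_{k\in\mathbb{Z}}$ is $R$-bounded.
   Context: $\mathbb{T}=\mathbb{R}/2\pi\mathbb{Z}$; functions on $\mathbb{T}$ are identified with $2\pi$-periodic functions on $\mathbb{R}$. For $u\in L^1(\mathbb{T};X)$, $\hat u(k)=\frac{1}{2\pi}\int_0^{2\pi}e^{-iks}u(s)\,ds$. $B_{j,k}:=e^{-ikr_j}B$, $\Delta_k:=ikI-A-\sum_{j=1}^nB_{j,k}$ with domain $D(A)$. $H^{1,p}(\mathbb{T};X)=\{u\in L^p(\mathbb{T};X):\exists v\in L^p(\mathbb{T};X),\ \hat v(k)=ik\hat u(k)\ \forall k\}$. A function $x\in H^{1,p}(\mathbb{T};X)$ is a $2\pi$-periodic strong $L^p$-solution of (E) if $x(t)\in D(A)$ for all $t$ and (E) holds a.e. A family $\mathcal{T}\subset\mathcal{B}(X)$ is $R$-bounded if there are $C>0$, $p\in[1,\infty)$ with $\|\sum_{l=1}^m r_lT_lx_l\|_{L^p(0,1;X)}\le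 C\|\sum_{l=1}^m r_lx_l\|_{L^p(0,1;X)}$ for all $m$, $T_l\in\mathcal{T}$, $x_l\in X$ and independent symmetric $\{-1,1\}$-valued random variables $r_l$ on $[0,1]$. *)

theory Defs
  imports "HOL-Analysis.Analysis" "HOL-Probability.Probability"
begin

text \<open>HOL-Analysis only provides real normed spaces; a complex Banach space is a
real Banach space with a compatible complex scalar multiplication.\<close>

class cbanach = banach +
  fixes scaleC :: "complex \<Rightarrow> 'a \<Rightarrow> 'a"  (infixr \<open>*\<^sub>C\<close> 75)
  assumes scaleC_add_right: "a *\<^sub>C (x + y) = a *\<^sub>C x + a *\<^sub>C y"
    and scaleC_add_left: "(a + b) *\<^sub>C x = a *\<^sub>C x + b *\<^sub>C x"
    and scaleC_scaleC: "a *\<^sub>C (b *\<^sub>C x) = (a * b) *\<^sub>C x"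
    and scaleC_one: "1 *\<^sub>C x = x"
    and scaleR_scaleC: "scaleR r x = complex_of_real r *\<^sub>C x"
    and norm_scaleC: "norm (a *\<^sub>C x) = cmod a * norm x"

definition cbounded_linear :: "('a::cbanach \<Rightarrow> 'a) \<Rightarrow> bool" where
  "cbounded_linear T \<longleftrightarrow> bounded_linear T \<and> (\<forall>c x. T (c *\<^sub>C x) = c *\<^sub>C T x)"

definition closed_linear_operator :: "'a::cbanach set \<Rightarrow> ('a \<Rightarrow> 'a) \<Rightarrow> bool" where
  "closed_linear_operator D A \<longleftrightarrow>
     0 \<in> D \<and> (\<forall>x\<in>D. \<forall>y\<in>D. x + y \<in> D) \<and> (\<forall>c. \<forall>x\<in>D. c *\<^sub>C x \<in> D) \<and>
     (\<forall>x\<in>D. \<forall>y\<in>D. A (x + y) = A x + A y) \<and> (\<forall>c. \<forall>x\<in>D. A (c *\<^sub>C x) = c *\<^sub>C A x) \<and>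
     closed {(x, A x) | x. x \<in> D}"

definition periodic2pi :: "(real \<Rightarrow> 'a) \<Rightarrow> bool" where
  "periodic2pi u \<longleftrightarrow> (\<forall>t. u (t + 2 * pi) = u t)"

text \<open>Membership in L^p(T;X) for a 2pi-periodic representative (strongly measurable,
p-th power of the norm integrable over one period).\<close>
definition Lp_T :: "real \<Rightarrow> (real \<Rightarrow> 'a::real_normed_vector) \<Rightarrow> bool" where
  "Lp_T p u \<longleftrightarrow> periodic2pi u \<and> u measurable_on {0..2*pi} \<and>
                  (\<lambda>s. norm (u s) powr p) integrable_on {0..2*pi}"

definition fourier_coeff :: "(real \<Rightarrow> 'a::cbanach) \<Rightarrow> int \<Rightarrow> 'a" where
  "fourier_coeff u k =
     complex_of_real (1 / (2 * pi)) *\<^sub>C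
       integral {0..2*pi} (\<lambda>s. exp (- \<i> * of_int k * complex_of_real s) *\<^sub>C u s)"

definition H1p_deriv :: "real \<Rightarrow> (real \<Rightarrow> 'a::cbanach) \<Rightarrow> (real \<Rightarrow> 'a) \<Rightarrow> bool" where
  "H1p_deriv p u v \<longleftrightarrow> Lp_T p u \<and> Lp_T p v \<and>
      (\<forall>k::int. fourier_coeff v k = (\<i> * of_int k) *\<^sub>C fourier_coeff u k)"

definition periodic_strong_solution ::
  "real \<Rightarrow> 'a::cbanach set \<Rightarrow> ('a \<Rightarrow> 'a) \<Rightarrow> ('a \<Rightarrow> 'a) \<Rightarrow> nat \<Rightarrow> (nat \<Rightarrow> real)
     \<Rightarrow> (real \<Rightarrow> 'a) \<Rightarrow> (real \<Rightarrow> 'a) \<Rightarrow> bool" where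
  "periodic_strong_solution p D A B n r f x \<longleftrightarrow>
     (\<exists>v. H1p_deriv p x v \<and>
          (\<forall>t. x t \<in> D) \<and>
          (AE t in lebesgue. v t = A (x t) + (\<Sum>j=1..n. B (x (t - r j))) + f t))"

definition Delta :: "('a::cbanach \<Rightarrow> 'a) \<Rightarrow> ('a \<Rightarrow> 'a) \<Rightarrow> nat \<Rightarrow> (nat \<Rightarrow> real) \<Rightarrow> int \<Rightarrow> 'a \<Rightarrow> 'a" where
  "Delta A B n r k x = (\<i> * of_int k) *\<^sub>C x - A x
      - (\<Sum>j=1..n. exp (- \<i> * of_int k * complex_of_real (r j)) *\<^sub>C B x)"

definition bounded_inverse :: "'a::cbanach set \<Rightarrow> ('a \<Rightarrow> 'a) \<Rightarrow> ('a \<Rightarrow> 'a) \<Rightarrow> bool" where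
  "bounded_inverse D T R \<longleftrightarrow> cbounded_linear R \<and>
     (\<forall>y. R y \<in> D \<and> T (R y) = y) \<and> (\<forall>x\<in>D. R (T x) = x)"

definition unit_interval_measure :: "real measure" where
  "unit_interval_measure = restrict_space lborel {0..1}"

definition rademacher_family :: "(nat \<Rightarrow> real \<Rightarrow> real) \<Rightarrow> nat \<Rightarrow> bool" where
  "rademacher_family rv m \<longleftrightarrow>
     prob_space.indep_vars unit_interval_measure (\<lambda>_. borel) rv {1..m} \<and>
     (\<forall>l\<in>{1..m}. (\<forall>t\<in>{0..1}. rv l t \<in> {-1, 1}) \<and>
        measure unit_interval_measure {t\<in>{0..1}. rv l t = 1} = 1/2 \<and>
        measure unit_interval_measure {t\<in>{0..1}. rv l t = -1} = 1/2)"

definition Lp01_norm :: "real \<Rightarrow> (real \<Rightarrow> 'a::real_normed_vector) \<Rightarrow> real" where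
  "Lp01_norm p g = (integral\<^sup>L unit_interval_measure (\<lambda>t. norm (g t) powr p)) powr (1 / p)"

definition R_bounded :: "('a::cbanach \<Rightarrow> 'a) set \<Rightarrow> bool" where
  "R_bounded \<T> \<longleftrightarrow> (\<exists>C>0. \<exists>p::real. 1 \<le> p \<and>
     (\<forall>m T x rv. rademacher_family rv m \<longrightarrow> (\<forall>l\<in>{1..m}. T l \<in> \<T>) \<longrightarrow>
        Lp01_norm p (\<lambda>t. \<Sum>l=1..m. rv l t *\<^sub>R T l (x l))
          \<le> C * Lp01_norm p (\<lambda>t. \<Sum>l=1..m. rv l t *\<^sub>R x l)))"

end

theory Submission
  imports Defs "HOL-Library.Function_Algebras"
begin

text \<open>
  Let \<open>G\<close> be the linear relation of all triples \<open>(f, x, x')\<close> such that \<open>x\<close> is a strong solution for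
  \<open>f\<close>. Since \<open>A\<close> is closed and every \<open>L\<^sup>p\<close>-convergent series has partial sums converging almost
  everywhere, \<open>G\<close> is closed, and a Baire category argument gives
  \<open>\<parallel>x\<parallel> + \<parallel>x'\<parallel> \<le> C \<parallel>f\<parallel>\<close> in \<open>L\<^sup>p\<close>. Taking the \<open>k\<close>-th Fourier coefficient of a solution for
  \<open>f = e\<^sup>i\<^sup>k\<^sup>t y\<close> shows that \<open>\<Delta>\<^sub>k\<close> is onto, and the bound for \<open>x = e\<^sup>i\<^sup>k\<^sup>t w\<close>, which solves the equation
  for \<open>f = e\<^sup>i\<^sup>k\<^sup>t \<Delta>\<^sub>k w\<close>, shows that it is bounded below. For R-boundedness the bound is applied to
  \<open>f = \<Sum> \<epsilon>\<^sub>l e\<^sup>i\<^sup>k\<^sup>(\<^sup>l\<^sup>)\<^sup>t x\<^sub>l\<close>; after averaging over the signs \<open>\<epsilon>\<^sub>l\<close> and over \<open>t\<close>, the unimodular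
  factors are removed by the contraction principle.
\<close>

section \<open>A closed graph theorem for seminorms\<close>

text \<open>The derivative is estimated along with the solution because it carries the factor
  \<open>ik\<close>: on the mode \<open>e^{ikt} w\<close> it equals \<open>e^{ikt} ik w\<close>. One
  constant thus controls every operator \<open>ik \<Delta>\<^sub>k\<^sup>-\<^sup>1\<close>, and, the
  relation being linear, also all signed sums of such modes. This is where uniformity over a family,
  beyond boundedness of each member, comes from. The circle and the random signs are given the same
  exponent \<open>p\<close>, so exchanging the two averages is exchanging an integral with a finite
  sum.

  The analytic obstacle is that the space may be nonseparable and \<open>A\<close> unbounded.
  Measurable functions are almost everywhere limits of continuous ones and Fourier coefficients are
  gauge integrals. Integrability is therefore obtained from the Cauchy criterion for Riemann sums,
  and \<open>A\<close> is moved through an integral by keeping the Riemann sums of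
  \<open>(w, A w)\<close> in its closed graph.\<close>

text \<open>Seminorms and a linear relation, rather than norms and a map: functions on the circle are not
  identified almost everywhere, so solutions are only unique up to null sets.\<close>

lemma closed_graph_seminorm:
  fixes V :: "'b::real_vector set" and G :: "('b \<times> 'c::real_vector) set"
    and N :: "'b \<Rightarrow> real" and M :: "'c \<Rightarrow> real"
  assumes V: "subspace V" and G: "subspace G" and fst_G: "fst ` G = V"
    and N_scale: "\<And>c f. f \<in> V \<Longrightarrow> N (c *\<^sub>R f) = \<bar>c\<bar> * N f"
    and N_triangle: "\<And>f g. f \<in> V \<Longrightarrow> g \<in> V \<Longrightarrow> N (f + g) \<le> N f + N g"
    and M_scale: "\<And>c w. w \<in> snd ` G \<Longrightarrow> M (c *\<^sub>R w) = \<bar>c\<bar> * M w"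
    and M_triangle: "\<And>w z. w \<in> snd ` G \<Longrightarrow> z \<in> snd ` G \<Longrightarrow> M (w + z) \<le> M w + M z"
    and complete: "\<And>u. (\<And>j. u j \<in> V) \<Longrightarrow> summable (\<lambda>j. N (u j)) \<Longrightarrow>
        \<exists>f\<in>V. (\<lambda>n. N (f - (\<Sum>j<n. u j))) \<longlonglongrightarrow> 0"
    and closed: "\<And>u w f. (\<And>j. (u j, w j) \<in> G) \<Longrightarrow> summable (\<lambda>j. N (u j)) \<Longrightarrow>
        summable (\<lambda>j. M (w j)) \<Longrightarrow> f \<in> V \<Longrightarrow> (\<lambda>n. N (f - (\<Sum>j<n. u j))) \<longlonglongrightarrow> 0 \<Longrightarrow>
        \<exists>z. (f, z) \<in> G \<and> M z \<le> (\<Sum>j. M (w j))"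
  shows "\<exists>C>0. \<forall>f\<in>V. \<forall>a>0. N f \<le> a \<longrightarrow> (\<exists>w. (f, w) \<in> G \<and> M w \<le> C * a)"
proof -
  note V_intros = subspace_0[OF V] subspace_add[OF V] subspace_diff[OF V] subspace_scale[OF V]
    subspace_sum[OF V]
  have G_V: "f \<in> V" if "(f, w) \<in> G" for f w
    using that fst_G by force
  have N_zero: "N 0 = 0"
    using N_scale[of 0 0] subspace_0[OF V] by simp
  have N_minus: "N (f - g) = N (g - f)" if "f \<in> V" "g \<in> V" for f g
    using N_scale[of "g - f" "-1"] that V_intros by simp
  have N_nonneg: "0 \<le> N f" if "f \<in> V" for f
    using N_triangle[of f "(-1) *\<^sub>R f"] N_scale[of f "-1"] that V_intros(4)[of f "-1"] N_zero by simp
  have N_diff: "N (f - h) \<le> N (f - g) + N (g - h)" if "f \<in> V" "g \<in> V" "h \<in> V" for f g h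
    using N_triangle[of "f - g" "g - h"] that V_intros by simp
  have M_nonneg: "0 \<le> M w" if "(f, w) \<in> G" for f w
  proof -
    have w: "w \<in> snd ` G" "(-1) *\<^sub>R w \<in> snd ` G"
      using that subspace_scale[OF G that, of "-1"] by force+
    have "0 \<in> snd ` G" using subspace_0[OF G] by (force simp: zero_prod_def)
    then have "M 0 = 0" using M_scale[of 0 0] by simp
    then show ?thesis
      using M_triangle[OF w] M_scale[OF w(1), of "-1"] by simp
  qed
  \<comment> \<open>Baire: were no \<open>A K\<close> dense in a ball, nested balls avoiding \<open>A 0\<close>, \<open>A 1\<close>, ... would shrink to a
    point outside \<open>fst ` G\<close>.\<close>
  define A where "A K = {f. \<exists>w. (f, w) \<in> G \<and> M w \<le> K}" for K
  have "\<exists>(K::nat) f0 \<rho>. f0 \<in> V \<and> \<rho> > 0 \<and>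
      (\<forall>f\<in>V. N (f - f0) \<le> \<rho> \<longrightarrow> (\<forall>\<epsilon>>0. \<exists>g\<in>A K. N (f - g) < \<epsilon>))"
  proof (rule ccontr)
    assume "\<not> ?thesis"
    then have sep: "\<exists>f\<in>V. N (f - f0) \<le> \<rho> \<and> (\<exists>\<epsilon>>0. \<forall>g\<in>A (real K). \<epsilon> \<le> N (f - g))"
      if "f0 \<in> V" "\<rho> > 0" for K f0 \<rho>
      using that by (meson not_less)
    \<comment> \<open>\<open>fst (s n)\<close> is the centre and \<open>snd (s n)\<close> the radius
      of the n-th ball. The factor 2 keeps every point of the next ball at distance at least
      \<open>snd (s (Suc n))\<close> from \<open>A n\<close>, and the halved step keeps the balls
      nested.\<close>
    have "\<exists>s::nat \<Rightarrow> 'b \<times> real. \<forall>n. (fst (s n) \<in> V \<and> 0 < snd (s n) \<and> snd (s n) \<le> (1/2)^n) \<and>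
       (N (fst (s (Suc n)) - fst (s n)) \<le> snd (s n) / 2 \<and> snd (s (Suc n)) \<le> snd (s n) / 2 \<and>
        (\<forall>g\<in>A (real n). 2 * snd (s (Suc n)) \<le> N (fst (s (Suc n)) - g)))"
    proof (rule dependent_nat_choice)
      show "\<exists>s::'b \<times> real. fst s \<in> V \<and> 0 < snd s \<and> snd s \<le> (1/2)^0"
        by (intro exI[of _ "(0, 1)"]) (simp add: V_intros)
    next
      fix s :: "'b \<times> real" and n
      assume s: "fst s \<in> V \<and> 0 < snd s \<and> snd s \<le> (1/2)^n"
      then obtain f \<epsilon> where f: "f \<in> V" "N (f - fst s) \<le> snd s / 2" "\<epsilon> > 0"
        "\<And>g. g \<in> A (real n) \<Longrightarrow> \<epsilon> \<le> N (f - g)"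
        using sep[of "fst s" "snd s / 2" n] by auto
      show "\<exists>s'. (fst s' \<in> V \<and> 0 < snd s' \<and> snd s' \<le> (1/2)^(Suc n)) \<and>
         (N (fst s' - fst s) \<le> snd s / 2 \<and> snd s' \<le> snd s / 2 \<and>
        (\<forall>g\<in>A (real n). 2 * snd s' \<le> N (fst s' - g)))"
        using s f by (intro exI[of _ "(f, min (snd s / 2) (\<epsilon> / 2))"]) force
    qed
    then obtain s :: "nat \<Rightarrow> 'b \<times> real" where
      s1: "\<And>n. fst (s n) \<in> V \<and> 0 < snd (s n) \<and> snd (s n) \<le> (1/2)^n" and
      s2: "\<And>n. N (fst (s (Suc n)) - fst (s n)) \<le> snd (s n) / 2 \<and> snd (s (Suc n)) \<le> snd (s n) / 2 \<and>
        (\<forall>g\<in>A (real n). 2 * snd (s (Suc n)) \<le> N (fst (s (Suc n)) - g))"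
      by auto
    have nested: "N (fst (s m) - fst (s n)) + snd (s m) \<le> snd (s n)" if "n \<le> m" for m n
      using that
    proof (induction m rule: dec_induct)
      case base
      then show ?case by (simp add: N_zero)
    next
      case (step m)
      then show ?case
        using N_diff[of "fst (s (Suc m))" "fst (s m)" "fst (s n)"] s1 s2[of m] by fastforce
    qed
    define u where "u j = fst (s (Suc j)) - fst (s j)" for j
    have u: "u j \<in> V" for j unfolding u_def using s1 V_intros by auto
    have "summable (\<lambda>j. N (u j))"
    proof (rule summable_comparison_test')
      show "summable (\<lambda>j. (1/2)^j :: real)" by simp
      show "norm (N (u j)) \<le> (1/2)^j" if "j \<ge> 0" for j
        using N_nonneg[OF u, of j] s2[of j] s1[of j] by (force simp: u_def)
    qed
    then obtain h where h: "h \<in> V" "(\<lambda>n. N (h - (\<Sum>j<n. u j))) \<longlonglongrightarrow> 0"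
      using complete[of u] u by blast
    have sum_u: "(\<Sum>j<n. u j) = fst (s n) - fst (s 0)" for n
      unfolding u_def by (rule sum_lessThan_telescope)
    define f where "f = h + fst (s 0)"
    have f: "f \<in> V" using h s1 V_intros unfolding f_def by auto
    have lim: "(\<lambda>n. N (f - fst (s n))) \<longlonglongrightarrow> 0"
      using h(2) unfolding sum_u f_def by (simp add: algebra_simps)
    \<comment> \<open>The limit point has a partner in \<open>G\<close> and hence lies in some
      \<open>A K\<close>, but it also lies in the ball that was chosen to avoid
      \<open>A K\<close>.\<close>
    obtain w where w: "(f, w) \<in> G" using f fst_G by auto
    obtain K :: nat where K: "M w \<le> K" using real_arch_simple by blast
    have "f \<in> A K" using w K unfolding A_def by auto
    then have far: "2 * snd (s (Suc K)) \<le> N (fst (s (Suc K)) - f)" using s2 by blast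
    have "N (fst (s (Suc K)) - f) \<le> 0 + snd (s (Suc K))"
    proof (rule tendsto_lowerbound)
      show "(\<lambda>n. N (f - fst (s n)) + snd (s (Suc K))) \<longlonglongrightarrow> 0 + snd (s (Suc K))"
        by (intro tendsto_intros lim)
      show "\<forall>\<^sub>F n in sequentially. N (fst (s (Suc K)) - f) \<le> N (f - fst (s n)) + snd (s (Suc K))"
        using eventually_ge_at_top[of "Suc K"]
      proof eventually_elim
        case (elim n)
        have "N (f - fst (s (Suc K))) \<le> N (f - fst (s n)) + N (fst (s n) - fst (s (Suc K)))"
          using N_diff f s1 by blast
        then show ?case using nested[OF elim] s1[of n] N_minus[OF f, of "fst (s (Suc K))"] s1 by fastforce
      qed
    qed simp
    then show False using far s1[of "Suc K"] by linarith
  qed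
  then obtain K :: nat and f0 \<rho> where f0: "f0 \<in> V" "\<rho> > 0"
    and dense: "\<And>f \<epsilon>. f \<in> V \<Longrightarrow> N (f - f0) \<le> \<rho> \<Longrightarrow> \<epsilon> > 0 \<Longrightarrow> \<exists>g\<in>A K. N (f - g) < \<epsilon>"
    by blast
  \<comment> \<open>Two elements of \<open>A K\<close> are subtracted below, which costs
    \<open>2 * real K\<close>; the added 1 keeps \<open>C\<close> positive when
    \<open>K = 0\<close>, and the division by \<open>\<rho>\<close> comes from rescaling.\<close>
  define C where "C = (2 * real K + 1) / \<rho>"
  have C: "C > 0" unfolding C_def using f0 by simp
  \<comment> \<open>Density is known only near \<open>f0\<close>. Subtracting approximants of
    \<open>f0 + c *\<^sub>R f\<close> and of \<open>f0\<close> moves it to the origin, with error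
    \<open>\<rho> / 2\<close>, that is \<open>a / 2\<close> after rescaling. The scale uses
    \<open>a > 0\<close> instead of \<open>N f\<close>, which may vanish for nonzero
    \<open>f\<close>.\<close>
  have halve: "\<exists>g w. (g, w) \<in> G \<and> M w \<le> C * a \<and> N (f - g) \<le> a / 2"
    if f: "f \<in> V" "a > 0" "N f \<le> a" for f a
  proof -
    define c where "c = \<rho> / a"
    have c: "c > 0" unfolding c_def using f f0 by simp
    have cf: "c *\<^sub>R f \<in> V" "N (c *\<^sub>R f) \<le> \<rho>"
      using V_intros f c N_scale[OF f(1), of c] mult_left_mono[OF f(3), of c] f0 by (auto simp: c_def)
    obtain g1 where g1: "g1 \<in> A K" "N (f0 + c *\<^sub>R f - g1) < \<rho> / 4"
      using dense[of "f0 + c *\<^sub>R f" "\<rho>/4"] cf f0 V_intros by auto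
    obtain g2 where g2: "g2 \<in> A K" "N (f0 - g2) < \<rho> / 4"
      using dense[of f0 "\<rho>/4"] f0 N_zero by auto
    obtain w1 w2 where w: "(g1, w1) \<in> G" "M w1 \<le> K" "(g2, w2) \<in> G" "M w2 \<le> K"
      using g1 g2 unfolding A_def by auto
    have g: "g1 \<in> V" "g2 \<in> V" using w G_V by auto
    have "(g1 - g2, w1 - w2) \<in> G"
      using subspace_diff[OF G w(1,3)] by simp
    then have wG: "(inverse c *\<^sub>R (g1 - g2), inverse c *\<^sub>R (w1 - w2)) \<in> G"
      and w12: "w1 - w2 \<in> snd ` G"
      using subspace_scale[OF G, of "(g1 - g2, w1 - w2)" "inverse c"] by force+
    have w1G: "w1 \<in> snd ` G" and w2G: "w2 \<in> snd ` G" and mw2: "(-1) *\<^sub>R w2 \<in> snd ` G"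
      using w(1,3) subspace_scale[OF G w(3), of "-1"] by force+
    have "M (w1 - w2) \<le> M w1 + M w2"
      using M_triangle[OF w1G mw2] M_scale[OF w2G, of "-1"] by simp
    then have "M (w1 - w2) \<le> 2 * K" using w by simp
    moreover have "M (inverse c *\<^sub>R (w1 - w2)) = inverse c * M (w1 - w2)"
      using M_scale[OF w12, of "inverse c"] c by simp
    ultimately have "M (inverse c *\<^sub>R (w1 - w2)) \<le> inverse c * (2 * K + 1)"
      using c by (intro order.trans[OF eq_refl mult_left_mono]) auto
    also have "\<dots> = C * a" unfolding C_def c_def by (simp add: field_simps)
    finally have 1: "M (inverse c *\<^sub>R (w1 - w2)) \<le> C * a" .
    have "f - inverse c *\<^sub>R (g1 - g2) = inverse c *\<^sub>R ((f0 + c *\<^sub>R f - g1) + (g2 - f0))"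
      using c by (simp add: algebra_simps)
    then have "N (f - inverse c *\<^sub>R (g1 - g2)) = inverse c * N ((f0 + c *\<^sub>R f - g1) + (g2 - f0))"
      using N_scale[of "(f0 + c *\<^sub>R f - g1) + (g2 - f0)" "inverse c"] c V_intros f0 cf g by simp
    also have "\<dots> \<le> inverse c * (N (f0 + c *\<^sub>R f - g1) + N (g2 - f0))"
      using c V_intros f0 cf g by (intro mult_left_mono N_triangle) auto
    also have "\<dots> \<le> inverse c * (\<rho> / 2)"
      using c g1 g2 N_minus[OF f0(1) g(2)] by (intro mult_left_mono) auto
    also have "\<dots> = a / 2" using f0 by (simp add: c_def)
    finally show ?thesis using 1 wG by blast
  qed
  \<comment> \<open>Successive approximation: the errors \<open>e n\<close> halve in each step and the corrections sum to \<open>f\<close>.\<close>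
  have "\<exists>w. (f, w) \<in> G \<and> M w \<le> (2 * C) * a" if f: "f \<in> V" "a > 0" "N f \<le> a" for f a
  proof -
    have "\<exists>e. \<forall>n. (e n \<in> V \<and> N (e n) \<le> a / 2 ^ n \<and> (n = 0 \<longrightarrow> e n = f)) \<and>
        (\<exists>w. (e n - e (Suc n), w) \<in> G \<and> M w \<le> C * (a / 2 ^ n))"
    proof (rule dependent_nat_choice)
      show "\<exists>e. e \<in> V \<and> N e \<le> a / 2 ^ 0 \<and> (0 = (0::nat) \<longrightarrow> e = f)" using f by auto
    next
      fix e and n :: nat
      assume e: "e \<in> V \<and> N e \<le> a / 2 ^ n \<and> (n = 0 \<longrightarrow> e = f)"
      then obtain g w where "(g, w) \<in> G" "M w \<le> C * (a / 2 ^ n)" "N (e - g) \<le> a / 2 ^ n / 2"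
        using halve[of e "a / 2 ^ n"] f by auto
      then show "\<exists>e'. (e' \<in> V \<and> N e' \<le> a / 2 ^ Suc n \<and> (Suc n = 0 \<longrightarrow> e' = f)) \<and>
        (\<exists>w. (e - e', w) \<in> G \<and> M w \<le> C * (a / 2 ^ n))"
        using e G_V V_intros by (intro exI[of _ "e - g"]) (auto simp: field_simps)
    qed
    then obtain e where e: "\<And>n. e n \<in> V" "\<And>n. N (e n) \<le> a / 2 ^ n" "e 0 = f"
      and "\<And>n. \<exists>w. (e n - e (Suc n), w) \<in> G \<and> M w \<le> C * (a / 2 ^ n)" by metis
    then obtain w where w: "\<And>n. (e n - e (Suc n), w n) \<in> G" "\<And>n. M (w n) \<le> C * (a / 2 ^ n)" by metis
    have geo: "summable (\<lambda>n. a / 2 ^ n)"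
      using summable_mult[OF summable_geometric[of "1/2::real"], of a] by (simp add: power_one_over)
    have geo_sum: "(\<Sum>n. a / 2 ^ n) = 2 * a"
      using suminf_mult[OF summable_geometric[of "1/2::real"], of a] suminf_geometric[of "1/2::real"]
      by (simp add: power_one_over)
    have sN: "summable (\<lambda>n. N (e n - e (Suc n)))"
    proof (rule summable_comparison_test')
      show "summable (\<lambda>n. a / 2 ^ n + a / 2 ^ n)" using geo by (intro summable_add)
      show "norm (N (e n - e (Suc n))) \<le> a / 2 ^ n + a / 2 ^ n" if "n \<ge> 0" for n
      proof -
        have "N (e n - e (Suc n)) \<le> N (e n) + N (e (Suc n))"
          using N_diff[of "e n" 0 "e (Suc n)"] N_minus[of 0 "e (Suc n)"] e V_intros by simp
        also have "\<dots> \<le> a / 2 ^ n + a / 2 ^ n"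
          using e(2)[of n] e(2)[of "Suc n"] f by (simp add: field_simps)
        finally show ?thesis using N_nonneg[of "e n - e (Suc n)"] e V_intros by simp
      qed
    qed
    have sM: "summable (\<lambda>n. M (w n))"
    proof (rule summable_comparison_test')
      show "summable (\<lambda>n. C * (a / 2 ^ n))" using geo by (rule summable_mult)
      show "norm (M (w n)) \<le> C * (a / 2 ^ n)" if "n \<ge> 0" for n
        using w M_nonneg[OF w(1)] by simp
    qed
    have "(\<lambda>n. N (f - (\<Sum>j<n. e j - e (Suc j)))) \<longlonglongrightarrow> 0"
    proof (rule tendsto_sandwich[OF _ _ tendsto_const])
      show "(\<lambda>n. a / 2 ^ n) \<longlonglongrightarrow> 0" using summable_LIMSEQ_zero[OF geo] .
    qed (use e in \<open>auto simp: sum_lessThan_telescope' N_nonneg\<close>)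
    then obtain z where z: "(f, z) \<in> G" "M z \<le> (\<Sum>j. M (w j))"
      using closed[of "\<lambda>j. e j - e (Suc j)" w f] w sN sM f by blast
    have "(\<Sum>j. M (w j)) \<le> (\<Sum>j. C * (a / 2 ^ j))"
      using w sM geo by (intro suminf_le summable_mult)
    also have "\<dots> = 2 * C * a"
      using suminf_mult[OF geo, of C] geo_sum by simp
    finally show ?thesis using z by auto
  qed
  then show ?thesis using C by (intro exI[of _ "2 * C"]) auto
qed

section \<open>Strongly measurable functions\<close>

lemma AE_lebesgue_on_iff_negligible:
  assumes "S \<in> sets lebesgue"
  shows "(AE t in lebesgue_on S. P t) \<longleftrightarrow> (\<exists>N. negligible N \<and> (\<forall>t\<in>S - N. P t))"
proof -
  have "(AE t in lebesgue_on S. P t) \<longleftrightarrow> (AE t in lebesgue. t \<in> S \<longrightarrow> P t)"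
    using assms by (intro AE_restrict_space_iff) simp
  also have "\<dots> \<longleftrightarrow> (\<exists>N. negligible N \<and> (\<forall>t\<in>S - N. P t))"
    unfolding eventually_ae_filter negligible_iff_null_sets by auto
  finally show ?thesis .
qed

lemma AE_lebesgue_iff_negligible:
  "(AE t in lebesgue. P t) \<longleftrightarrow> (\<exists>N. negligible N \<and> (\<forall>t. t \<notin> N \<longrightarrow> P t))"
  unfolding eventually_ae_filter negligible_iff_null_sets by auto

lemma measurable_on_norm:
  assumes "u measurable_on S" "S \<in> sets lebesgue"
  shows "(\<lambda>t. norm (u t)) \<in> borel_measurable (lebesgue_on S)"
proof -
  have "(norm \<circ> u) measurable_on S"
    using assms by (intro measurable_on_compose_continuous_0) (auto intro: continuous_intros)
  then show ?thesis
    using measurable_on_imp_borel_measurable_lebesgue assms by (simp add: o_def)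
qed

lemma continuous_measurable_on:
  assumes "continuous_on UNIV h" "S \<in> sets lebesgue"
  shows "h measurable_on S"
  using measurable_on_restrict[OF continuous_imp_measurable_on[OF assms(1)] assms(2)]
  by (simp add: measurable_on_UNIV)

lemma finite_measure_lebesgue_on_Icc: "finite_measure (lebesgue_on {a..b::real})"
  by (rule finite_measureI) (simp add: emeasure_restrict_space emeasure_lborel_Icc_eq)

text \<open>Provides the continuous comparison functions for the integrability criterion below and
  for the measurability of limits in \<open>L\<^sup>p\<close>. The error splits into
  \<open>u - trunc K u\<close> and the difference of the truncations of \<open>u\<close> and of an
  approximant; each part receives \<open>e / 2\<close>.\<close>

lemma continuous_L1_approximation:
  fixes u :: "real \<Rightarrow> 'a::real_normed_vector"
  assumes u: "u measurable_on {a..b}" "integrable (lebesgue_on {a..b}) (\<lambda>t. norm (u t))" and e: "e > 0"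
  shows "\<exists>h. continuous_on UNIV h \<and> integrable (lebesgue_on {a..b}) (\<lambda>t. norm (u t - h t)) \<and>
    (\<integral>t. norm (u t - h t) \<partial>lebesgue_on {a..b}) < e"
proof -
  let ?M = "lebesgue_on {a..b}"
  \<comment> \<open>Radial truncation makes the continuous approximants bounded, so that dominated convergence applies.\<close>
  define trunc where "trunc K x = (K / max K (norm x)) *\<^sub>R x" for K :: real and x :: 'a
  have cont: "continuous_on UNIV (trunc K)" if "K > 0" for K
    unfolding trunc_def using that by (intro continuous_intros) auto
  have trunc_0: "trunc K 0 = 0" for K unfolding trunc_def by simp
  have trunc_le: "norm (trunc K x) \<le> K" if "K > 0" for K x
    using that by (simp add: trunc_def divide_simps)
  have trunc_eq: "trunc K x = x" if "K > 0" "norm x \<le> K" for K x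
    using that by (simp add: trunc_def)
  have trunc_diff: "norm (x - trunc K x) \<le> norm x" if K: "K > 0" for K x
  proof -
    have "x - trunc K x = (1 - K / max K (norm x)) *\<^sub>R x"
      by (simp add: trunc_def algebra_simps)
    moreover have "\<bar>1 - K / max K (norm x)\<bar> \<le> 1" using K by (auto simp: divide_simps)
    ultimately show ?thesis by (simp add: mult_left_le_one_le)
  qed
  have mtrunc: "(\<lambda>t. trunc K (u t)) measurable_on {a..b}" if "K > 0" for K
    using measurable_on_compose_continuous_0[OF u(1) cont[OF that] trunc_0] by (simp add: o_def)
  have "(\<lambda>n. \<integral>t. norm (u t - trunc (real (Suc n)) (u t)) \<partial>?M) \<longlonglongrightarrow> (\<integral>t. 0 \<partial>?M)"
  proof (rule integral_dominated_convergence[OF _ _ u(2)])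
    show "(\<lambda>t. norm (u t - trunc (real (Suc n)) (u t))) \<in> borel_measurable ?M" for n
      by (intro measurable_on_norm measurable_on_diff u mtrunc) auto
    show "AE t in ?M. (\<lambda>n. norm (u t - trunc (real (Suc n)) (u t))) \<longlonglongrightarrow> 0"
    proof (rule AE_I2)
      fix t
      obtain n0 :: nat where n0: "norm (u t) \<le> n0" using real_arch_simple by blast
      show "(\<lambda>n. norm (u t - trunc (real (Suc n)) (u t))) \<longlonglongrightarrow> 0"
        by (rule tendsto_eventually, rule eventually_sequentiallyI[of n0])
           (use n0 in \<open>auto simp: trunc_eq\<close>)
    qed
    show "AE t in ?M. norm (norm (u t - trunc (real (Suc n)) (u t))) \<le> norm (u t)" for n
      by (rule AE_I2) (simp add: trunc_diff)
  qed simp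
  then have "\<forall>\<^sub>F n in sequentially. (\<integral>t. norm (u t - trunc (real (Suc n)) (u t)) \<partial>?M) < e / 2"
    using e by (intro order_tendstoD(2)) auto
  then have "\<exists>n. (\<integral>t. norm (u t - trunc (real (Suc n)) (u t)) \<partial>?M) < e / 2"
    using eventually_happens'[OF sequentially_bot] by blast
  then obtain K :: real where K: "K > 0" "(\<integral>t. norm (u t - trunc K (u t)) \<partial>?M) < e / 2"
    by (metis of_nat_0_less_iff zero_less_Suc)
  have int1: "integrable ?M (\<lambda>t. norm (u t - trunc K (u t)))"
    by (rule Bochner_Integration.integrable_bound[OF u(2)])
       (auto intro!: measurable_on_norm measurable_on_diff u mtrunc K AE_I2 trunc_diff)
  \<comment> \<open>The approximants converge to \<open>u\<close> extended by zero off the interval,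
    hence the conditional; only points of the interval are used afterwards.\<close>
  obtain N g where N: "negligible N" and g: "\<And>n. continuous_on UNIV (g n)"
    and lim: "\<And>t. t \<notin> N \<Longrightarrow> (\<lambda>n. g n t) \<longlonglongrightarrow> (if t \<in> {a..b} then u t else 0)"
    using u(1) unfolding measurable_on_def by (auto simp del: atLeastAtMost_iff)
  have ctg: "continuous_on UNIV (\<lambda>t. trunc K (g n t))" for n
    using continuous_on_compose2[OF cont[OF K(1)] g] by auto
  have mg: "(\<lambda>t. norm (trunc K (u t) - trunc K (g n t))) \<in> borel_measurable ?M" for n
    by (intro measurable_on_norm measurable_on_diff mtrunc K continuous_measurable_on ctg) auto
  have bound: "norm (trunc K x - trunc K y) \<le> 2 * K" for x y
    using norm_triangle_ineq4[of "trunc K x" "trunc K y"] trunc_le[OF K(1), of x] trunc_le[OF K(1), of y]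
    by linarith
  have const: "integrable ?M (\<lambda>t. 2 * K)"
    by (rule finite_measure.integrable_const[OF finite_measure_lebesgue_on_Icc])
  have "(\<lambda>n. \<integral>t. norm (trunc K (u t) - trunc K (g n t)) \<partial>?M) \<longlonglongrightarrow> (\<integral>t. 0 \<partial>?M)"
  proof (rule integral_dominated_convergence[OF _ mg const])
    have "(\<lambda>n. norm (trunc K (u t) - trunc K (g n t))) \<longlonglongrightarrow> 0" if "t \<in> {a..b} - N" for t
    proof -
      have "isCont (trunc K) (u t)" using cont[OF K(1)] by (simp add: continuous_on_eq_continuous_at)
      then have "(\<lambda>n. trunc K (g n t)) \<longlonglongrightarrow> trunc K (u t)"
        by (rule isCont_tendsto_compose) (use lim[of t] that in simp)
      from tendsto_norm[OF tendsto_diff[OF tendsto_const[of "trunc K (u t)"] this]]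
      show ?thesis by simp
    qed
    then show "AE t in ?M. (\<lambda>n. norm (trunc K (u t) - trunc K (g n t))) \<longlonglongrightarrow> 0"
      using N by (subst AE_lebesgue_on_iff_negligible) auto
    show "AE t in ?M. norm (norm (trunc K (u t) - trunc K (g n t))) \<le> 2 * K" for n
      by (rule AE_I2) (simp add: bound)
  qed simp
  then have "\<forall>\<^sub>F n in sequentially. (\<integral>t. norm (trunc K (u t) - trunc K (g n t)) \<partial>?M) < e / 2"
    using e by (intro order_tendstoD(2)) auto
  then obtain n where n: "(\<integral>t. norm (trunc K (u t) - trunc K (g n t)) \<partial>?M) < e / 2"
    using eventually_happens'[OF sequentially_bot] by blast
  have int2: "integrable ?M (\<lambda>t. norm (trunc K (u t) - trunc K (g n t)))"
    by (rule Bochner_Integration.integrable_bound[OF const])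
       (use K in \<open>auto intro!: AE_I2 mg bound\<close>)
  have tri: "norm (u t - trunc K (g n t)) \<le>
      norm (u t - trunc K (u t)) + norm (trunc K (u t) - trunc K (g n t))" for t
    using norm_triangle_ineq[of "u t - trunc K (u t)" "trunc K (u t) - trunc K (g n t)"] by simp
  have int3: "integrable ?M (\<lambda>t. norm (u t - trunc K (g n t)))"
  proof (rule Bochner_Integration.integrable_bound[OF Bochner_Integration.integrable_add[OF int1 int2]])
    show "(\<lambda>t. norm (u t - trunc K (g n t))) \<in> borel_measurable ?M"
      by (intro measurable_on_norm measurable_on_diff u continuous_measurable_on ctg) auto
  qed (use tri in \<open>auto intro!: AE_I2\<close>)
  have "(\<integral>t. norm (u t - trunc K (g n t)) \<partial>?M) \<le>
     (\<integral>t. norm (u t - trunc K (u t)) + norm (trunc K (u t) - trunc K (g n t)) \<partial>?M)"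
    by (intro integral_mono int3 Bochner_Integration.integrable_add int1 int2 tri)
  also have "\<dots> < e" using int1 int2 K n by simp
  finally show ?thesis using ctg int3 by blast
qed

text \<open>The Cauchy criterion asks only that any two fine Riemann sums be close. Both are
  compared with the integral of a continuous function that is close to \<open>u\<close> in the
  \<open>L\<^sup>1\<close> norm, so no separability of the values is involved.\<close>

lemma strongly_measurable_norm_integrable_imp_integrable_on:
  fixes u :: "real \<Rightarrow> 'a::banach"
  assumes u: "u measurable_on {a..b}" "integrable (lebesgue_on {a..b}) (\<lambda>t. norm (u t))"
  shows "u integrable_on {a..b}"
proof -
  have "\<exists>\<gamma>. gauge \<gamma> \<and> (\<forall>\<D>1 \<D>2. \<D>1 tagged_division_of cbox a b \<and> \<gamma> fine \<D>1 \<and>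
       \<D>2 tagged_division_of cbox a b \<and> \<gamma> fine \<D>2 \<longrightarrow>
       norm ((\<Sum>(x,k)\<in>\<D>1. measure lborel k *\<^sub>R u x) - (\<Sum>(x,k)\<in>\<D>2. measure lborel k *\<^sub>R u x)) < e)"
    if e: "e > 0" for e
  proof -
    \<comment> \<open>Budget: a fine Riemann sum of \<open>norm (u - h)\<close> is below
      \<open>e / 8 + e / 8\<close>, a Riemann sum of \<open>h\<close> misses its integral by at most
      \<open>e / 8\<close>, so each of the two sums for \<open>u\<close> stays within
      \<open>e / 2\<close> of \<open>H\<close>.\<close>
    obtain h where h: "continuous_on UNIV h" "integrable (lebesgue_on {a..b}) (\<lambda>t. norm (u t - h t))"
      "(\<integral>t. norm (u t - h t) \<partial>lebesgue_on {a..b}) < e / 8"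
      using continuous_L1_approximation[OF u, of "e/8"] e by auto
    define I where "I = (\<integral>t. norm (u t - h t) \<partial>lebesgue_on {a..b})"
    have "((\<lambda>t. norm (u t - h t)) has_integral I) (cbox a b)"
      unfolding I_def using has_integral_integral_lebesgue_on[OF h(2)] by simp
    from this[unfolded has_integral, rule_format, of "e/8"] e obtain \<gamma>1 where g1: "gauge \<gamma>1" "\<And>\<D>. \<D> tagged_division_of cbox a b \<Longrightarrow> \<gamma>1 fine \<D> \<Longrightarrow>
        norm ((\<Sum>(x,k)\<in>\<D>. measure lborel k *\<^sub>R norm (u x - h x)) - I) < e / 8"
      by auto
    have "h integrable_on cbox a b"
      using h(1) by (intro integrable_continuous) (auto intro: continuous_on_subset)
    then obtain H where "(h has_integral H) (cbox a b)" by (auto simp: integrable_on_def)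
    from this[unfolded has_integral, rule_format, of "e/8"] e obtain \<gamma>2 where g2: "gauge \<gamma>2" "\<And>\<D>. \<D> tagged_division_of cbox a b \<Longrightarrow> \<gamma>2 fine \<D> \<Longrightarrow>
        norm ((\<Sum>(x,k)\<in>\<D>. measure lborel k *\<^sub>R h x) - H) < e / 8"
      by auto
    \<comment> \<open>Riemann sums of \<open>u\<close> and \<open>h\<close> differ by at most a Riemann sum of \<open>norm (u - h)\<close>, whose integral is small.\<close>
    have close: "norm ((\<Sum>(x,k)\<in>\<D>. measure lborel k *\<^sub>R u x) - H) < e / 2"
      if \<D>: "\<D> tagged_division_of cbox a b" "(\<lambda>x. \<gamma>1 x \<inter> \<gamma>2 x) fine \<D>" for \<D>
    proof -
      have fine: "\<gamma>1 fine \<D>" "\<gamma>2 fine \<D>" using \<D> by (auto simp: fine_Int)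
      have "norm ((\<Sum>(x,k)\<in>\<D>. measure lborel k *\<^sub>R u x) - (\<Sum>(x,k)\<in>\<D>. measure lborel k *\<^sub>R h x))
          = norm (\<Sum>(x,k)\<in>\<D>. measure lborel k *\<^sub>R (u x - h x))"
        by (simp add: sum_subtractf[symmetric] split_beta scaleR_diff_right)
      also have "\<dots> \<le> (\<Sum>(x,k)\<in>\<D>. measure lborel k *\<^sub>R norm (u x - h x))"
        by (rule order.trans[OF norm_sum]) (simp add: split_beta)
      also have "\<dots> < e / 4" using g1(2)[OF \<D>(1) fine(1)] h(3) unfolding I_def real_norm_def by linarith
      finally have "norm ((\<Sum>(x,k)\<in>\<D>. measure lborel k *\<^sub>R u x) - (\<Sum>(x,k)\<in>\<D>. measure lborel k *\<^sub>R h x)) < e / 4" .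
      then show ?thesis
        using g2(2)[OF \<D>(1) fine(2)] e
          norm_triangle_ineq[of "(\<Sum>(x,k)\<in>\<D>. measure lborel k *\<^sub>R u x) - (\<Sum>(x,k)\<in>\<D>. measure lborel k *\<^sub>R h x)"
            "(\<Sum>(x,k)\<in>\<D>. measure lborel k *\<^sub>R h x) - H"] by simp
    qed
    show ?thesis
    proof (intro exI[of _ "\<lambda>x. \<gamma>1 x \<inter> \<gamma>2 x"] conjI allI impI)
      show "gauge (\<lambda>x. \<gamma>1 x \<inter> \<gamma>2 x)" using g1 g2 by (intro gauge_Int)
      fix \<D>1 \<D>2
      assume "\<D>1 tagged_division_of cbox a b \<and> (\<lambda>x. \<gamma>1 x \<inter> \<gamma>2 x) fine \<D>1 \<and>
        \<D>2 tagged_division_of cbox a b \<and> (\<lambda>x. \<gamma>1 x \<inter> \<gamma>2 x) fine \<D>2"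
      then show "norm ((\<Sum>(x,k)\<in>\<D>1. measure lborel k *\<^sub>R u x) - (\<Sum>(x,k)\<in>\<D>2. measure lborel k *\<^sub>R u x)) < e"
        using close[of \<D>1] close[of \<D>2] norm_triangle_ineq4[of "(\<Sum>(x,k)\<in>\<D>1. measure lborel k *\<^sub>R u x) - H"
          "(\<Sum>(x,k)\<in>\<D>2. measure lborel k *\<^sub>R u x) - H"] by simp
    qed
  qed
  then have "u integrable_on cbox a b" by (subst integrable_Cauchy) blast
  then show ?thesis by simp
qed

section \<open>The spaces \<open>L\<^sup>p\<close> on the circle\<close>

text \<open>Pointwise scaling completes the pointwise addition of functions to a real vector space,
  so that \<open>subspace\<close> and the closed graph lemma apply to sets of functions.\<close>

instantiation "fun" :: (type, real_vector) real_vector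
begin

definition scaleR_fun_def: "c *\<^sub>R f = (\<lambda>t. c *\<^sub>R f t)"

instance
  by standard (simp_all add: scaleR_fun_def fun_eq_iff scaleR_add_right scaleR_add_left)

end

section \<open>Convexity of powers and the Minkowski inequality\<close>

lemma powr_convex_nonneg:
  fixes x y l p :: real
  assumes p: "1 \<le> p" and x: "0 \<le> x" and y: "0 \<le> y" and l: "0 \<le> l" "l \<le> 1"
  shows "((1 - l) * x + l * y) powr p \<le> (1 - l) * x powr p + l * y powr p"
proof -
  have le: "(c * z) powr p \<le> c * z powr p" if "0 \<le> c" "c \<le> 1" "0 \<le> z" for c z
  proof -
    have "c powr p \<le> c powr 1" using that p by (intro powr_mono') auto
    then show ?thesis using that by (simp add: powr_mult mult_right_mono)
  qed
  \<comment> \<open>Convexity is applied at two positive points; at the boundary the claim reduces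
    to \<open>c powr p \<le> c\<close> for \<open>c\<close> between 0 and 1.\<close>
  consider "x = 0" | "y = 0" | "x > 0" "y > 0" using x y by linarith
  then show ?thesis
  proof cases
    case 3
    then show ?thesis using convex_onD[OF powr_convex[OF p], of l x y] l by simp
  qed (use le[of l y] le[of "1 - l" x] l x y in auto)
qed

text \<open>For positive \<open>a\<close> and \<open>b\<close>, convexity with weights
  \<open>a / (a + b)\<close> and \<open>b / (a + b)\<close> bounds the integrand. If
  \<open>a\<close> and \<open>b\<close> strictly exceed the two norms, integrating gives at most
  \<open>(a + b) powr p\<close>; then \<open>a\<close> and \<open>b\<close> decrease to the norms.
  Strict excess avoids dividing by a norm that is zero.\<close>

lemma
  fixes f g :: "'b \<Rightarrow> real"
  assumes p: "1 \<le> p" and f: "f \<in> borel_measurable M" "\<And>x. 0 \<le> f x" "integrable M (\<lambda>x. f x powr p)"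
    and g: "g \<in> borel_measurable M" "\<And>x. 0 \<le> g x" "integrable M (\<lambda>x. g x powr p)"
  shows integrable_add_powr: "integrable M (\<lambda>x. (f x + g x) powr p)"
    and Minkowski_inequality: "(\<integral>x. (f x + g x) powr p \<partial>M) powr (1 / p) \<le>
      (\<integral>x. f x powr p \<partial>M) powr (1 / p) + (\<integral>x. g x powr p \<partial>M) powr (1 / p)"
proof -
  have pw: "(f x + g x) powr p \<le> (a + b) powr p *
      (a / (a + b) * (f x powr p / a powr p) + b / (a + b) * (g x powr p / b powr p))"
    if ab: "a > 0" "b > 0" for a b x
  proof -
    define l where "l = b / (a + b)"
    have l: "0 \<le> l" "l \<le> 1" "1 - l = a / (a + b)" using ab by (auto simp: l_def field_simps)
    have "f x + g x = (a + b) * ((1 - l) * (f x / a) + l * (g x / b))"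
      unfolding l(3) unfolding l_def using ab by (simp add: distrib_left)
    then have "(f x + g x) powr p = (a + b) powr p * ((1 - l) * (f x / a) + l * (g x / b)) powr p"
      using ab l f(2) g(2) by (simp add: powr_mult)
    also have "\<dots> \<le> (a + b) powr p * ((1 - l) * (f x / a) powr p + l * (g x / b) powr p)"
      using ab l f(2) g(2) p by (intro mult_left_mono powr_convex_nonneg) auto
    finally show ?thesis
      using ab f(2) g(2) by (simp add: l(3) powr_divide) (simp add: l_def)
  qed
  have rhs: "integrable M (\<lambda>x. (a + b) powr p *
      (a / (a + b) * (f x powr p / a powr p) + b / (a + b) * (g x powr p / b powr p)))" for a b
    using f(3) g(3) by auto
  show int: "integrable M (\<lambda>x. (f x + g x) powr p)"
  proof (rule Bochner_Integration.integrable_bound[OF rhs[of 1 1]])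
    show "AE x in M. norm ((f x + g x) powr p) \<le> norm ((1 + 1) powr p *
      (1 / (1 + 1) * (f x powr p / 1 powr p) + 1 / (1 + 1) * (g x powr p / 1 powr p)))"
      using pw[of 1 1] by (intro AE_I2) (force simp: abs_le_iff intro: order.trans)
  qed (use f(1) g(1) in measurable)
  define F where "F = (\<integral>x. f x powr p \<partial>M)"
  define G where "G = (\<integral>x. g x powr p \<partial>M)"
  have FG: "0 \<le> F" "0 \<le> G" by (simp_all add: F_def G_def)
  have bound: "(\<integral>x. (f x + g x) powr p \<partial>M) powr (1 / p) \<le> a + b"
    if a: "F powr (1/p) < a" and b: "G powr (1/p) < b" for a b
  proof -
    have ab: "a > 0" "b > 0" using a b by (meson le_less_trans powr_ge_zero)+
    have "F = (F powr (1/p)) powr p" "G = (G powr (1/p)) powr p" using FG p by (simp_all add: powr_powr)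
    then have FG_le: "F \<le> a powr p" "G \<le> b powr p"
      using a b p by (metis less_eq_real_def powr_ge_zero powr_mono2 zero_le_one order.trans)+
    have "(\<integral>x. (f x + g x) powr p \<partial>M) \<le> (\<integral>x. (a + b) powr p *
      (a / (a + b) * (f x powr p / a powr p) + b / (a + b) * (g x powr p / b powr p)) \<partial>M)"
      using ab by (intro integral_mono int rhs pw)
    also have "\<dots> = (a + b) powr p * (a / (a + b) * (F / a powr p) + b / (a + b) * (G / b powr p))"
      using f(3) g(3) by (simp add: F_def G_def)
    also have "\<dots> \<le> (a + b) powr p * (a / (a + b) * 1 + b / (a + b) * 1)"
      using ab FG_le by (intro mult_left_mono add_mono) auto
    also have "\<dots> = (a + b) powr p" using ab by (simp add: add_divide_distrib[symmetric])
    finally have "(\<integral>x. (f x + g x) powr p \<partial>M) powr (1/p) \<le> ((a + b) powr p) powr (1/p)"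
      using p by (intro powr_mono2) auto
    then show ?thesis using ab p by (simp add: powr_powr)
  qed
  show "(\<integral>x. (f x + g x) powr p \<partial>M) powr (1 / p) \<le>
      (\<integral>x. f x powr p \<partial>M) powr (1 / p) + (\<integral>x. g x powr p \<partial>M) powr (1 / p)"
    unfolding F_def[symmetric] G_def[symmetric]
  proof (rule field_le_epsilon)
    fix e :: real assume "e > 0"
    then show "(\<integral>x. (f x + g x) powr p \<partial>M) powr (1 / p) \<le> F powr (1/p) + G powr (1/p) + e"
      using bound[of "F powr (1/p) + e/2" "G powr (1/p) + e/2"] by simp
  qed
qed

abbreviation circle :: "real measure" where
  "circle \<equiv> lebesgue_on {0..2 * pi}"

text \<open>A seminorm on \<open>Lp_T\<close> for \<open>p \<ge> 1\<close>, with Lebesgue measure on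
  the period not divided by its length.\<close>

definition Lp_norm :: "real \<Rightarrow> (real \<Rightarrow> 'a::real_normed_vector) \<Rightarrow> real" where
  "Lp_norm p u = (\<integral>t. norm (u t) powr p \<partial>circle) powr (1 / p)"

lemma Lp_norm_nonneg: "0 \<le> Lp_norm p u"
  by (simp add: Lp_norm_def)

lemma Lp_norm_powr: "p > 0 \<Longrightarrow> Lp_norm p u powr p = (\<integral>t. norm (u t) powr p \<partial>circle)"
  by (simp add: Lp_norm_def powr_powr)

text \<open>For the nonnegative function \<open>norm (u t) powr p\<close>, gauge integrability and
  Lebesgue integrability coincide.\<close>

lemma Lp_T_iff:
  "Lp_T p u \<longleftrightarrow> periodic2pi u \<and> u measurable_on {0..2*pi} \<and> integrable circle (\<lambda>t. norm (u t) powr p)"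
proof -
  have "(\<lambda>t. norm (u t) powr p) integrable_on {0..2*pi} \<Longrightarrow> integrable circle (\<lambda>t. norm (u t) powr p)"
    by (intro absolutely_integrable_imp_integrable nonnegative_absolutely_integrable_1) auto
  then show ?thesis
    using integrable_on_lebesgue_on[of "{0..2*pi}" "\<lambda>t. norm (u t) powr p"] by (auto simp: Lp_T_def)
qed

lemma measurable_on_norm_circle:
  "u measurable_on {0..2*pi} \<Longrightarrow> (\<lambda>t. norm (u t)) \<in> borel_measurable circle"
  by (intro measurable_on_norm) auto

lemma Lp_T_0: "Lp_T p (\<lambda>t. 0)"
  by (simp add: Lp_T_iff periodic2pi_def)

lemma Lp_T_dominated:
  fixes u :: "real \<Rightarrow> 'a::real_normed_vector"
  assumes "0 \<le> p" and "periodic2pi u" "u measurable_on {0..2*pi}"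
    and "integrable circle (\<lambda>t. g t powr p)" and "\<And>t. norm (u t) \<le> g t"
  shows "Lp_T p u" "(\<integral>t. norm (u t) powr p \<partial>circle) \<le> (\<integral>t. g t powr p \<partial>circle)"
proof -
  note [measurable] = measurable_on_norm_circle[OF assms(3)]
  have le: "norm (u t) powr p \<le> g t powr p" for t
    using assms by (intro powr_mono2) auto
  have "integrable circle (\<lambda>t. norm (u t) powr p)"
    by (rule Bochner_Integration.integrable_bound[OF assms(4)]) (use le in auto)
  then show "Lp_T p u" "(\<integral>t. norm (u t) powr p \<partial>circle) \<le> (\<integral>t. g t powr p \<partial>circle)"
    using assms le by (auto simp: Lp_T_iff intro!: integral_mono)
qed

lemma
  fixes u v :: "real \<Rightarrow> 'a::real_normed_vector"
  assumes p: "1 \<le> p" and u: "Lp_T p u" and v: "Lp_T p v"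
  shows Lp_T_add: "Lp_T p (u + v)"
    and Lp_norm_triangle: "Lp_norm p (u + v) \<le> Lp_norm p u + Lp_norm p v"
proof -
  note uv = u[unfolded Lp_T_iff] v[unfolded Lp_T_iff]
  note [measurable] = measurable_on_norm_circle[of u] measurable_on_norm_circle[of v]
  have int: "integrable circle (\<lambda>t. (norm (u t) + norm (v t)) powr p)"
    using uv p by (intro integrable_add_powr measurable_on_norm_circle) auto
  have 1: "periodic2pi (u + v)" "(u + v) measurable_on {0..2*pi}"
    using uv by (auto simp: periodic2pi_def plus_fun_def intro: measurable_on_add)
  show "Lp_T p (u + v)"
    by (rule Lp_T_dominated[OF _ 1 int]) (use p in \<open>auto intro: norm_triangle_ineq\<close>)
  have "(\<integral>t. norm ((u + v) t) powr p \<partial>circle) \<le> (\<integral>t. (norm (u t) + norm (v t)) powr p \<partial>circle)"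
    by (rule Lp_T_dominated(2)[OF _ 1 int]) (use p in \<open>auto intro: norm_triangle_ineq\<close>)
  then have "Lp_norm p (u + v) \<le> (\<integral>t. (norm (u t) + norm (v t)) powr p \<partial>circle) powr (1 / p)"
    unfolding Lp_norm_def using p by (intro powr_mono2) auto
  also have "\<dots> \<le> Lp_norm p u + Lp_norm p v"
    unfolding Lp_norm_def using uv p by (intro Minkowski_inequality measurable_on_norm_circle) auto
  finally show "Lp_norm p (u + v) \<le> Lp_norm p u + Lp_norm p v" .
qed

lemma Lp_T_scaleR: "Lp_T p u \<Longrightarrow> Lp_T p (c *\<^sub>R u)"
  by (auto simp: Lp_T_iff scaleR_fun_def periodic2pi_def powr_mult intro: measurable_on_scaleR_const)

lemma Lp_norm_scaleR: "p > 0 \<Longrightarrow> Lp_norm p (c *\<^sub>R u) = \<bar>c\<bar> * Lp_norm p u"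
  by (simp add: Lp_norm_def scaleR_fun_def powr_mult powr_powr)

lemma subspace_Lp_T: "1 \<le> p \<Longrightarrow> subspace {u. Lp_T p u}"
  using Lp_T_add Lp_T_scaleR Lp_T_0 by (auto simp: subspace_def zero_fun_def)

text \<open>The elementary bound \<open>x \<le> 1 + x powr p\<close> is applied to
  \<open>norm (u t) / a\<close> with \<open>a\<close> slightly above the \<open>L\<^sup>p\<close>
  norm. The constant is the length of the period plus 1; only its independence of \<open>u\<close>
  matters.\<close>

lemma
  fixes u :: "real \<Rightarrow> 'a::real_normed_vector"
  assumes p: "1 \<le> p" and u: "Lp_T p u"
  shows Lp_T_norm_integrable: "integrable circle (\<lambda>t. norm (u t))"
    and L1_norm_le_Lp_norm: "(\<integral>t. norm (u t) \<partial>circle) \<le> (2 * pi + 1) * Lp_norm p u"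
proof -
  have le: "x \<le> 1 + x powr p" if "0 \<le> x" for x :: real
  proof (cases "x \<le> 1")
    case False
    then have "x powr 1 \<le> x powr p" using p by (intro powr_mono) auto
    then show ?thesis using False by simp
  qed (use powr_ge_zero[of x p] in linarith)
  have const: "integrable circle (\<lambda>t. 1::real)"
    by (rule finite_measure.integrable_const[OF finite_measure_lebesgue_on_Icc])
  have measure: "measure circle {0..2*pi} = 2 * pi"
    by (simp add: measure_restrict_space)
  have up: "integrable circle (\<lambda>t. norm (u t) powr p)" using u by (simp add: Lp_T_iff)
  show int: "integrable circle (\<lambda>t. norm (u t))"
  proof (rule Bochner_Integration.integrable_bound[OF Bochner_Integration.integrable_add[OF const up]])
    show "(\<lambda>t. norm (u t)) \<in> borel_measurable circle"
      using u by (simp add: Lp_T_iff measurable_on_norm_circle)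
  qed (use le in auto)
  have bound: "(\<integral>t. norm (u t) \<partial>circle) \<le> (2 * pi + 1) * a" if a: "a > Lp_norm p u" for a
  proof -
    have a0: "a > 0" using a Lp_norm_nonneg[of p u] by linarith
    have "(\<integral>t. norm (u t) powr p \<partial>circle) \<le> a powr p"
      using a p Lp_norm_nonneg[of p u] by (simp add: Lp_norm_powr[symmetric] powr_mono2)
    then have "(\<integral>t. norm (u t) powr p \<partial>circle) / a powr p \<le> 1" using a0 by simp
    have "(\<integral>t. norm (u t) \<partial>circle) / a = (\<integral>t. norm (u t) / a \<partial>circle)" by simp
    also have "\<dots> \<le> (\<integral>t. 1 + norm (u t) powr p / a powr p \<partial>circle)"
    proof (rule integral_mono)
      show "norm (u t) / a \<le> 1 + norm (u t) powr p / a powr p" for t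
        using le[of "norm (u t) / a"] a0 by (simp add: powr_divide)
    qed (use int up const in auto)
    also have "\<dots> = 2 * pi + (\<integral>t. norm (u t) powr p \<partial>circle) / a powr p"
      using up const measure by simp
    also have "\<dots> \<le> 2 * pi + 1" using \<open>_ \<le> 1\<close> by simp
    finally show ?thesis using a0 by (simp add: field_simps)
  qed
  show "(\<integral>t. norm (u t) \<partial>circle) \<le> (2 * pi + 1) * Lp_norm p u"
  proof (rule field_le_epsilon)
    fix e :: real assume e: "e > 0"
    have pos: "0 < 2 * pi + 1" using pi_gt_zero by linarith
    then show "(\<integral>t. norm (u t) \<partial>circle) \<le> (2 * pi + 1) * Lp_norm p u + e"
      using bound[of "Lp_norm p u + e / (2 * pi + 1)"] e by (simp add: distrib_left)
  qed
qed

section \<open>Periodicity and null sets\<close>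

lemma periodic2pi_of_int:
  assumes "periodic2pi u"
  shows "u (t + 2 * pi * of_int k) = u t"
proof (induction k rule: int_induct[where k = 0])
  case (step1 i)
  then show ?case
    using assms[unfolded periodic2pi_def, rule_format, of "t + 2 * pi * of_int i"] by (simp add: algebra_simps)
next
  case (step2 i)
  then show ?case
    using assms[unfolded periodic2pi_def, rule_format, of "t + 2 * pi * of_int (i - 1)"]
    by (simp add: algebra_simps)
qed simp

lemma period_reduce:
  obtains k :: int where "t + 2 * pi * of_int k \<in> {0..2 * pi}"
proof
  show "t + 2 * pi * of_int (- \<lfloor>t / (2 * pi)\<rfloor>) \<in> {0..2 * pi}"
    using floor_divide_lower[of "2 * pi" t] floor_divide_upper[of "2 * pi" t] by (simp add: algebra_simps)
qed

text \<open>The exceptional set on the line is covered by countably many translates of a null set in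
  one period. This reconciles the norms, taken over a period, with the equation, required almost
  everywhere on the line.\<close>

lemma AE_circle_imp_AE_lebesgue:
  assumes "periodic2pi P" and "AE t in circle. P t"
  shows "AE t in lebesgue. P t"
proof -
  obtain N where N: "negligible N" "\<And>t. t \<in> {0..2*pi} - N \<Longrightarrow> P t"
    using assms(2) by (subst (asm) AE_lebesgue_on_iff_negligible) auto
  have "negligible (\<Union>k::int. (+) (- 2 * pi * of_int k) ` N)"
    by (rule negligible_countable_Union, simp, elim rangeE, simp only: negligible_translation N(1))
  moreover have "P t" if t: "t \<notin> (\<Union>k::int. (+) (- 2 * pi * of_int k) ` N)" for t
  proof -
    obtain k :: int where k: "t + 2 * pi * of_int k \<in> {0..2 * pi}" by (rule period_reduce)
    have "t + 2 * pi * of_int k \<notin> N"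
    proof
      assume "t + 2 * pi * of_int k \<in> N"
      then have "- 2 * pi * of_int k + (t + 2 * pi * of_int k) \<in> (\<Union>k::int. (+) (- 2 * pi * of_int k) ` N)"
        by blast
      then show False using t by simp
    qed
    then have "P (t + 2 * pi * of_int k)" using N(2) k by blast
    then show "P t" using periodic2pi_of_int[OF assms(1)] by simp
  qed
  ultimately show ?thesis unfolding AE_lebesgue_iff_negligible by blast
qed

lemma AE_lebesgue_imp_AE_circle: "AE t in lebesgue. P t \<Longrightarrow> AE t in circle. P t"
  by (subst AE_restrict_space_iff) (auto elim: eventually_mono)

text \<open>Serves the delayed arguments \<open>t - r j\<close>, where exceptional sets are shifted
  along with the function.\<close>

lemma AE_lebesgue_translate:
  fixes P :: "real \<Rightarrow> bool"
  assumes "AE t in lebesgue. P t"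
  shows "AE t in lebesgue. P (t - c)"
proof -
  obtain N where N: "negligible N" "\<And>t. t \<notin> N \<Longrightarrow> P t"
    using assms unfolding AE_lebesgue_iff_negligible by blast
  have "P (t - c)" if "t \<notin> (+) c ` N" for t
    using N(2)[of "t - c"] that by (metis add.commute diff_add_cancel image_eqI)
  then show ?thesis unfolding AE_lebesgue_iff_negligible using negligible_translation[OF N(1)] by blast
qed

section \<open>Completeness\<close>

lemma AE_summable_of_summable_integrals:
  fixes f :: "nat \<Rightarrow> 'b \<Rightarrow> real"
  assumes f: "\<And>j. integrable M (f j)" "\<And>j x. 0 \<le> f j x" and s: "summable (\<lambda>j. \<integral>x. f j x \<partial>M)"
  shows "AE x in M. summable (\<lambda>j. f j x)"
proof -
  note [measurable] = borel_measurable_integrable[OF f(1)]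
  have "(\<integral>\<^sup>+x. (\<Sum>j. ennreal (f j x)) \<partial>M) = (\<Sum>j. \<integral>\<^sup>+x. ennreal (f j x) \<partial>M)"
    by (intro nn_integral_suminf) measurable
  also have "\<dots> = (\<Sum>j. ennreal (\<integral>x. f j x \<partial>M))"
    using f by (simp add: nn_integral_eq_integral)
  also have "\<dots> = ennreal (\<Sum>j. \<integral>x. f j x \<partial>M)"
    using f s by (intro suminf_ennreal2) auto
  finally have "(\<integral>\<^sup>+x. (\<Sum>j. ennreal (f j x)) \<partial>M) \<noteq> \<infinity>" by simp
  then have "AE x in M. (\<Sum>j. ennreal (f j x)) \<noteq> \<infinity>"
    by (intro nn_integral_PInf_AE) auto
  then show ?thesis
    by eventually_elim (use f(2) in \<open>auto intro: summable_suminf_not_top\<close>)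
qed

text \<open>\<open>measurable_on\<close> requires convergence on the whole line to the function
  extended by zero, so the given functions are multiplied by continuous cut-offs that equal 1 on the
  interval and eventually vanish at each point outside it.\<close>

lemma measurable_on_Icc_AE_limit:
  fixes s :: "real \<Rightarrow> 'a::real_normed_vector"
  assumes h: "\<And>n. continuous_on UNIV (h n)"
    and lim: "AE t in lebesgue_on {a..b}. (\<lambda>n. h n t) \<longlonglongrightarrow> s t"
  shows "s measurable_on {a..b}"
proof -
  obtain N where N: "negligible N" "\<And>t. t \<in> {a..b} - N \<Longrightarrow> (\<lambda>n. h n t) \<longlonglongrightarrow> s t"
    using lim by (subst (asm) AE_lebesgue_on_iff_negligible) auto
  \<comment> \<open>\<open>d\<close> vanishes exactly on the interval; for \<open>a \<le> b\<close>
    it is the distance to it.\<close>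
  define d where "d t = max 0 (a - t) + max 0 (t - b)" for t
  define g where "g n t = max 0 (1 - real n * d t) *\<^sub>R h n t" for n t
  have "continuous_on UNIV (g n)" for n
    unfolding g_def d_def by (intro continuous_intros h)
  moreover have "(\<lambda>n. g n t) \<longlonglongrightarrow> (if t \<in> {a..b} then s t else 0)" if "t \<notin> N" for t
  proof (cases "t \<in> {a..b}")
    case True
    then have "g n t = h n t" for n by (simp add: g_def d_def)
    then show ?thesis using True N(2)[of t] that by simp
  next
    case False
    then have d: "d t > 0" by (auto simp: d_def)
    obtain n0 :: nat where n0: "1 < real n0 * d t"
      using reals_Archimedean3[OF d] by blast
    have "g n t = 0" if "n \<ge> n0" for n
    proof -
      have "real n0 * d t \<le> real n * d t" using that d by (intro mult_right_mono) auto
      then show ?thesis using n0 by (simp add: g_def)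
    qed
    then show ?thesis using False
      by (auto intro!: tendsto_eventually eventually_sequentiallyI)
  qed
  ultimately show ?thesis unfolding measurable_on_def using N(1) by blast
qed

lemma Lp_T_sum: "1 \<le> p \<Longrightarrow> (\<And>j. Lp_T p (u j)) \<Longrightarrow> Lp_T p (\<Sum>j\<in>J. u j)"
  using subspace_sum[OF subspace_Lp_T, of p J u] by simp

lemma Lp_norm_sum_le:
  assumes p: "1 \<le> p" and u: "\<And>j. Lp_T p (u j)" and "finite J"
  shows "Lp_norm p (\<Sum>j\<in>J. u j) \<le> (\<Sum>j\<in>J. Lp_norm p (u j))"
  using assms(3)
proof induction
  case empty
  then show ?case by (simp add: Lp_norm_def)
next
  case (insert j J)
  have "Lp_norm p (u j + sum u J) \<le> Lp_norm p (u j) + Lp_norm p (sum u J)"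
    by (intro Lp_norm_triangle p u Lp_T_sum)
  then show ?case unfolding sum.insert[OF insert.hyps] using insert.IH by linarith
qed

lemma sum_fun_apply: "(\<Sum>j\<in>J. u j) t = (\<Sum>j\<in>J. u j t)"
  by (induction J rule: infinite_finite_induct) auto

text \<open>The limit is built pointwise, so that the full sequence of partial sums converges almost
  everywhere. This allows a closed operator to be applied at a fixed \<open>t\<close>, which
  convergence in norm alone would not.\<close>

theorem Riesz_Fischer:
  fixes u :: "nat \<Rightarrow> real \<Rightarrow> 'a::banach"
  assumes p: "1 \<le> p" and u: "\<And>j. Lp_T p (u j)" and sum: "summable (\<lambda>j. Lp_norm p (u j))"
  obtains s where "Lp_T p s" and "AE t in lebesgue. (\<lambda>j. u j t) sums s t"
    and "\<And>n. Lp_norm p (s - (\<Sum>j<n. u j)) \<le> (\<Sum>j. Lp_norm p (u (j + n)))"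
proof
  \<comment> \<open>The summability condition is itself periodic in \<open>t\<close>; together with
    the default 0 it makes \<open>s\<close> periodic at every point and not only off a null
    set.\<close>
  define s where "s t = (if summable (\<lambda>j. norm (u j t)) then \<Sum>j. u j t else 0)" for t
  define S where "S n = (\<Sum>j<n. u j)" for n
  have S_apply: "S n t = (\<Sum>j<n. u j t)" for n t by (simp add: S_def sum_fun_apply)
  have Lp_S: "Lp_T p (S n)" for n unfolding S_def using Lp_T_sum[OF p u] .
  have per_u: "u j (t + 2 * pi) = u j t" for j t
    using u[of j] by (simp add: Lp_T_iff periodic2pi_def)
  have per: "periodic2pi s" by (simp add: periodic2pi_def s_def per_u)
  have "AE t in circle. summable (\<lambda>j. norm (u j t))"
  proof (rule AE_summable_of_summable_integrals)
    show "summable (\<lambda>j. \<integral>t. norm (u j t) \<partial>circle)"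
    proof (rule summable_comparison_test')
      show "summable (\<lambda>j. (2 * pi + 1) * Lp_norm p (u j))" using sum by (rule summable_mult)
      show "norm (\<integral>t. norm (u j t) \<partial>circle) \<le> (2 * pi + 1) * Lp_norm p (u j)" if "j \<ge> 0" for j
        using L1_norm_le_Lp_norm[OF p u, of j] by simp
    qed
  qed (auto intro: Lp_T_norm_integrable[OF p u])
  then have abs: "AE t in circle. (\<lambda>j. u j t) sums s t"
    by eventually_elim (auto simp: s_def intro: summable_sums summable_norm_cancel)
  show "AE t in lebesgue. (\<lambda>j. u j t) sums s t"
    by (rule AE_circle_imp_AE_lebesgue[OF _ abs]) (use per in \<open>simp add: periodic2pi_def per_u\<close>)
  have lim: "AE t in circle. (\<lambda>n. S n t) \<longlonglongrightarrow> s t"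
    using abs by (simp add: S_apply sums_def)
  \<comment> \<open>Strong measurability of \<open>s\<close>: continuous functions that are \<open>2\<^sup>-\<^sup>n\<close>-close to \<open>S n\<close> in \<open>L\<^sup>1\<close> have the same
    limit almost everywhere.\<close>
  have "\<forall>n. \<exists>h. continuous_on UNIV h \<and> integrable circle (\<lambda>t. norm (S n t - h t)) \<and>
    (\<integral>t. norm (S n t - h t) \<partial>circle) < (1/2)^n" (is "\<forall>n. \<exists>h. ?approx n h")
  proof
    show "\<exists>h. ?approx n h" for n
    using Lp_S[of n] by (intro continuous_L1_approximation Lp_T_norm_integrable[OF p]) (auto simp: Lp_T_iff)
  qed
  from choice[OF this] obtain h where h: "\<And>n. continuous_on UNIV (h n)"
    "\<And>n. integrable circle (\<lambda>t. norm (S n t - h n t))"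
    "\<And>n. (\<integral>t. norm (S n t - h n t) \<partial>circle) < (1/2)^n" by blast
  have "AE t in circle. summable (\<lambda>n. norm (S n t - h n t))"
  proof (rule AE_summable_of_summable_integrals[OF h(2)])
    show "summable (\<lambda>n. \<integral>t. norm (S n t - h n t) \<partial>circle)"
      by (rule summable_comparison_test'[OF summable_geometric[of "1/2"]])
         (use h(3) in \<open>auto intro: less_imp_le\<close>)
  qed simp
  then have "AE t in circle. (\<lambda>n. h n t) \<longlonglongrightarrow> s t"
    using lim
  proof eventually_elim
    case (elim t)
    have "(\<lambda>n. S n t - h n t) \<longlonglongrightarrow> 0"
      using summable_LIMSEQ_zero[OF elim(1)] by (rule tendsto_norm_zero_cancel)
    from tendsto_diff[OF elim(2) this] show ?case by simp
  qed
  then have meas: "s measurable_on {0..2*pi}"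
    by (rule measurable_on_Icc_AE_limit[OF h(1)])
  \<comment> \<open>Fatou's lemma is applied to \<open>S (m + n) - S n\<close> as \<open>m\<close>
    grows, all of whose norms are at most the tail \<open>T\<close>. The case \<open>n = 0\<close>
    gives membership of \<open>s\<close> in \<open>Lp_T\<close>.\<close>
  have tail: "integrable circle (\<lambda>t. norm ((s - S n) t) powr p) \<and>
      Lp_norm p (s - S n) \<le> (\<Sum>j. Lp_norm p (u (j + n)))" for n
  proof -
    define T where "T = (\<Sum>j. Lp_norm p (u (j + n)))"
    have sumn: "summable (\<lambda>j. Lp_norm p (u (j + n)))" using sum by (rule summable_ignore_initial_segment)
    then have T0: "0 \<le> T" unfolding T_def by (intro suminf_nonneg) (auto simp: Lp_norm_nonneg)
    have LpSS: "Lp_T p (S (m + n) - S n)" for m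
      using subspace_diff[OF subspace_Lp_T[OF p], of "S (m + n)" "S n"] Lp_S by simp
    have meas2: "(s - S n) measurable_on {0..2*pi}"
      using meas Lp_S[of n] by (auto simp: Lp_T_iff fun_diff_def intro: measurable_on_diff)
    have int_le: "(\<integral>\<^sup>+t. ennreal (norm ((S (m + n) - S n) t) powr p) \<partial>circle) \<le> ennreal (T powr p)" for m
    proof -
      have "S (m + n) - S n = (\<Sum>j<m. u (j + n))"
        unfolding S_def by (induction m) (simp_all add: fun_eq_iff algebra_simps)
      then have "Lp_norm p (S (m + n) - S n) \<le> (\<Sum>j<m. Lp_norm p (u (j + n)))"
        using Lp_norm_sum_le[of p "\<lambda>j. u (j + n)" "{..<m}"] p u by simp
      also have "\<dots> \<le> T"
        unfolding T_def using sumn by (intro sum_le_suminf) (auto simp: Lp_norm_nonneg)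
      finally have "Lp_norm p (S (m + n) - S n) powr p \<le> T powr p"
        using p by (intro powr_mono2) (auto simp: Lp_norm_nonneg)
      then show ?thesis
        using LpSS[of m] p by (simp add: Lp_T_iff nn_integral_eq_integral Lp_norm_powr)
    qed
    have "(\<integral>\<^sup>+t. ennreal (norm ((s - S n) t) powr p) \<partial>circle) =
        (\<integral>\<^sup>+t. liminf (\<lambda>m. ennreal (norm ((S (m + n) - S n) t) powr p)) \<partial>circle)"
    proof (rule nn_integral_cong_AE, use lim in eventually_elim)
      case (elim t)
      have "(\<lambda>m. S (m + n) t - S n t) \<longlonglongrightarrow> s t - S n t"
        by (intro tendsto_diff tendsto_const LIMSEQ_ignore_initial_segment elim)
      then have "(\<lambda>m. ennreal (norm ((S (m + n) - S n) t) powr p)) \<longlonglongrightarrow> ennreal (norm ((s - S n) t) powr p)"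
        using p by (intro tendsto_ennrealI tendsto_powr' tendsto_norm tendsto_const) auto
      from lim_imp_Liminf[OF sequentially_bot this] show ?case by (rule sym)
    qed
    also have "\<dots> \<le> liminf (\<lambda>m. \<integral>\<^sup>+t. ennreal (norm ((S (m + n) - S n) t) powr p) \<partial>circle)"
    proof (rule nn_integral_liminf)
      fix m
      have "(\<lambda>t. norm ((S (m + n) - S n) t)) \<in> borel_measurable circle"
        using measurable_on_norm_circle[of "S (m + n) - S n"] LpSS[of m] unfolding Lp_T_iff by blast
      then show "(\<lambda>t. ennreal (norm ((S (m + n) - S n) t) powr p)) \<in> borel_measurable circle"
        by measurable
    qed
    also have "\<dots> \<le> ennreal (T powr p)"
      using int_le by (intro Liminf_le) auto
    finally have fin: "(\<integral>\<^sup>+t. ennreal (norm ((s - S n) t) powr p) \<partial>circle) \<le> ennreal (T powr p)" .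
    have m: "(\<lambda>t. norm ((s - S n) t)) \<in> borel_measurable circle"
      by (rule measurable_on_norm_circle[OF meas2])
    have int: "integrable circle (\<lambda>t. norm ((s - S n) t) powr p)"
    proof (rule integrableI_bounded)
      show "(\<lambda>t. norm ((s - S n) t) powr p) \<in> borel_measurable circle" using m by measurable
      show "(\<integral>\<^sup>+ t. ennreal (norm (norm ((s - S n) t) powr p)) \<partial>circle) < \<infinity>"
        using fin by (auto intro: le_less_trans)
    qed
    have "(\<integral>t. norm ((s - S n) t) powr p \<partial>circle) \<le> T powr p"
      using fin int by (simp add: nn_integral_eq_integral)
    then have "Lp_norm p (s - S n) \<le> (T powr p) powr (1 / p)"
      unfolding Lp_norm_def using p by (intro powr_mono2) auto
    also have "\<dots> = T" using T0 p by (simp add: powr_powr)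
    finally show ?thesis using int unfolding T_def by blast
  qed
  show "Lp_T p s" using tail[of 0] meas per by (simp add: Lp_T_iff S_apply)
  show "Lp_norm p (s - (\<Sum>j<n. u j)) \<le> (\<Sum>j. Lp_norm p (u (j + n)))" for n
    using tail[of n] unfolding S_def by blast
qed

section \<open>Fourier coefficients\<close>

lemma bounded_bilinear_scaleC: "bounded_bilinear (scaleC :: complex \<Rightarrow> 'a::cbanach \<Rightarrow> 'a)"
proof
  fix a b :: complex and x y :: 'a and r :: real
  show "(a + b) *\<^sub>C x = a *\<^sub>C x + b *\<^sub>C x" by (rule scaleC_add_left)
  show "a *\<^sub>C (x + y) = a *\<^sub>C x + a *\<^sub>C y" by (rule scaleC_add_right)
  show "(r *\<^sub>R a) *\<^sub>C x = r *\<^sub>R (a *\<^sub>C x)"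
    by (simp add: scaleR_scaleC scaleC_scaleC scaleR_conv_of_real)
  show "a *\<^sub>C (r *\<^sub>R x) = r *\<^sub>R (a *\<^sub>C x)"
    by (simp add: scaleR_scaleC scaleC_scaleC mult.commute)
  show "\<exists>K. \<forall>(a::complex) (x::'a). norm (a *\<^sub>C x) \<le> norm a * norm x * K"
    by (rule exI[of _ 1]) (simp add: norm_scaleC)
qed

interpretation scaleC: bounded_bilinear "scaleC :: complex \<Rightarrow> 'a::cbanach \<Rightarrow> 'a"
  by (rule bounded_bilinear_scaleC)

lemmas scaleC_simps = scaleC.add_left scaleC.add_right scaleC.diff_left scaleC.diff_right
  scaleC.minus_left scaleC.minus_right scaleC.zero_left scaleC.zero_right scaleC.scaleR_left scaleC.scaleR_right

definition mode :: "int \<Rightarrow> 'a::cbanach \<Rightarrow> real \<Rightarrow> 'a" where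
  "mode k y t = exp (\<i> * of_int k * complex_of_real t) *\<^sub>C y"

lemma norm_exp_i_real: "cmod (exp (\<i> * of_int k * complex_of_real t)) = 1"
  "cmod (exp (- \<i> * of_int k * complex_of_real t)) = 1"
  by (simp_all add: norm_exp_eq_Re)

lemma norm_mode: "norm (mode k y t) = norm y"
  by (simp add: mode_def norm_scaleC norm_exp_i_real)

lemma exp_of_int_periodic:
  "exp (\<i> * of_int k * complex_of_real (t + 2 * pi)) = exp (\<i> * of_int k * complex_of_real t)"
proof -
  have "exp (\<i> * of_int k * complex_of_real (t + 2 * pi)) =
      exp (\<i> * of_int k * complex_of_real t + of_int (2 * k) * (complex_of_real pi * \<i>))"
    by (simp add: algebra_simps)
  then show ?thesis by (subst (asm) exp_add) (simp add: exp_eq_1 exp_add)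
qed

lemma exp_minus_of_int_periodic:
  "exp (- \<i> * of_int k * complex_of_real (t + 2 * pi)) = exp (- \<i> * of_int k * complex_of_real t)"
  using exp_of_int_periodic[of "- k" t] by simp

lemma continuous_on_mode: "continuous_on S (mode k y)"
  unfolding mode_def by (intro continuous_intros scaleC.continuous_on)

lemma Lp_T_mode:
  assumes p: "1 \<le> p" shows "Lp_T p (mode k y)"
proof -
  have "integrable circle (\<lambda>t. norm y powr p)"
    by (rule finite_measure.integrable_const[OF finite_measure_lebesgue_on_Icc])
  then show ?thesis
    by (auto simp: Lp_T_iff norm_mode periodic2pi_def intro!: continuous_measurable_on continuous_on_mode)
       (simp add: mode_def exp_of_int_periodic[simplified])
qed

section \<open>Closed operators and translations under the integral\<close>

lemma has_integral_closed_subspace: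
  fixes f :: "real \<Rightarrow> 'b::real_normed_vector"
  assumes G: "subspace G" "closed G" and f: "\<And>t. f t \<in> G" and y: "(f has_integral y) {a..b}"
  shows "y \<in> G"
proof -
  have "\<exists>z\<in>G. dist z y < e" if e: "e > 0" for e
  proof -
    obtain \<gamma> where \<gamma>: "gauge \<gamma>" "\<And>\<D>. \<D> tagged_division_of {a..b} \<Longrightarrow> \<gamma> fine \<D> \<Longrightarrow>
        norm ((\<Sum>(x,k)\<in>\<D>. measure lborel k *\<^sub>R f x) - y) < e"
      using y[unfolded has_integral_real, rule_format, OF e] by auto
    obtain \<D> where \<D>: "\<D> tagged_division_of {a..b}" "\<gamma> fine \<D>"
      using fine_division_exists_real[OF \<gamma>(1)] by blast
    have "(\<Sum>(x,k)\<in>\<D>. measure lborel k *\<^sub>R f x) \<in> G"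
      using G(1) f by (auto intro!: subspace_sum subspace_scale)
    then show ?thesis using \<gamma>(2)[OF \<D>] by (auto simp: dist_norm)
  qed
  then show ?thesis using closed_approachable[OF G(2)] by blast
qed

lemma subspace_operator_graph:
  assumes "closed_linear_operator D A"
  shows "subspace {(x, A x) | x. x \<in> D}"
proof -
  note A = assms[unfolded closed_linear_operator_def]
  have "A (0 *\<^sub>C 0) = 0 *\<^sub>C A 0" using A by blast
  then have "A 0 = 0" by (simp add: scaleC_simps)
  then show ?thesis using A unfolding subspace_def
    by (auto simp: zero_prod_def scaleR_scaleC)
qed

text \<open>Hille's theorem for the gauge integral: Riemann sums of \<open>(w, A w)\<close> are real
  linear combinations of points of the graph, so they and their limit stay in this closed
  subspace.\<close>

lemma closed_operator_has_integral:
  assumes A: "closed_linear_operator D A" and w: "\<And>t. w t \<in> D" "(w has_integral I) {a..b::real}"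
    and Aw: "((\<lambda>t. A (w t)) has_integral J) {a..b}"
  shows "I \<in> D" "A I = J"
proof -
  have 1: "((\<lambda>t. (w t, 0::'a)) has_integral (I, 0)) {a..b}"
    using has_integral_linear[OF w(2), of "\<lambda>x. (x, 0)"]
    by (simp add: o_def bounded_linear_Pair bounded_linear_ident bounded_linear_zero)
  have 2: "((\<lambda>t. (0::'a, A (w t))) has_integral (0, J)) {a..b}"
    using has_integral_linear[OF Aw, of "\<lambda>x. (0, x)"]
    by (simp add: o_def bounded_linear_Pair bounded_linear_ident bounded_linear_zero)
  have int: "((\<lambda>t. (w t, A (w t))) has_integral (I, J)) {a..b}"
    using has_integral_add[OF 1 2] by simp
  have cl: "closed {(x, A x) | x. x \<in> D}" using A by (simp add: closed_linear_operator_def)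
  have "(w t, A (w t)) \<in> {(x, A x) | x. x \<in> D}" for t using w(1) by blast
  from has_integral_closed_subspace[OF subspace_operator_graph[OF A] cl this int]
  have "(I, J) \<in> {(x, A x) | x. x \<in> D}" .
  then show "I \<in> D" "A I = J" by auto
qed

text \<open>\<open>a\<close> is \<open>c\<close> modulo the period. The period is cut at
  \<open>a\<close>: the shifted function runs first through the piece after \<open>a\<close> and
  then, one period later, through the piece before it.\<close>

lemma periodic_has_integral_translate:
  fixes F :: "real \<Rightarrow> 'a::banach"
  assumes per: "periodic2pi F" and F: "(F has_integral I) {0..2*pi}"
  shows "((\<lambda>s. F (s + c)) has_integral I) {0..2*pi}"
proof -
  obtain k :: int where k: "c + 2 * pi * of_int k \<in> {0..2 * pi}" by (rule period_reduce)
  define a where "a = c + 2 * pi * of_int k"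
  have a: "0 \<le> a" "a \<le> 2 * pi" using k by (auto simp: a_def)
  have eq: "F (s + c) = F (s + a)" for s
    using periodic2pi_of_int[OF per, of "s + c" k] by (simp add: a_def add.assoc)
  have "F integrable_on {0..2*pi}" using F by (rule has_integral_integrable)
  then have "F integrable_on {0..a}" "F integrable_on {a..2*pi}"
    by (rule integrable_subinterval_real; use a in simp)+
  then obtain I1 I2 where I: "(F has_integral I1) {0..a}" "(F has_integral I2) {a..2*pi}"
    unfolding integrable_on_def by blast
  have sum: "I = I1 + I2"
    using has_integral_unique[OF F has_integral_combine[OF a I]] .
  have 1: "((\<lambda>s. F (s + a)) has_integral I2) {0..2*pi - a}"
    using I(2) has_integral_shift_Icc_real[of F a I2 0 "2*pi - a"] by (simp add: o_def add.commute)
  have "((F \<circ> (+) (a - 2 * pi)) has_integral I1) {2*pi - a..2*pi}"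
    using I(1) has_integral_shift_Icc_real[of F "a - 2*pi" I1 "2*pi - a" "2*pi"] by simp
  moreover have "F (s + (a - 2 * pi)) = F (s + a)" for s
    using per[unfolded periodic2pi_def, rule_format, of "s + (a - 2 * pi)"] by (simp add: algebra_simps)
  ultimately have 2: "((\<lambda>s. F (s + a)) has_integral I1) {2*pi - a..2*pi}"
    by (simp add: o_def add.commute)
  show ?thesis unfolding eq
    using has_integral_combine[OF _ _ 1 2] a by (simp add: sum add.commute)
qed

lemma measurable_on_scaleC:
  assumes "continuous_on UNIV \<phi>" "u measurable_on S" "S \<in> sets lebesgue"
  shows "(\<lambda>t. \<phi> t *\<^sub>C u t) measurable_on S"
  by (rule measurable_on_combine[where h = scaleC, OF continuous_measurable_on[OF assms(1,3)] assms(2)])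
     (auto intro!: scaleC.continuous_on continuous_intros simp: scaleC.zero_left)

lemma Lp_T_fourier_integrable:
  assumes p: "1 \<le> p" and u: "Lp_T p u"
  shows "(\<lambda>s. exp (- \<i> * of_int k * complex_of_real s) *\<^sub>C u s) integrable_on {0..2*pi}"
proof (rule strongly_measurable_norm_integrable_imp_integrable_on)
  show "(\<lambda>s. exp (- \<i> * of_int k * complex_of_real s) *\<^sub>C u s) measurable_on {0..2*pi}"
    using u by (intro measurable_on_scaleC continuous_intros) (auto simp: Lp_T_iff)
  show "integrable circle (\<lambda>s. norm (exp (- \<i> * of_int k * complex_of_real s) *\<^sub>C u s))"
    using Lp_T_norm_integrable[OF p u] by (simp add: norm_scaleC norm_exp_i_real del: mult_minus_left)
qed

text \<open>Integrability is what gives the total function \<open>integral\<close> in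
  \<open>fourier_coeff\<close> its meaning; the identities below are therefore proved with
  \<open>has_integral\<close>.\<close>

lemma fourier_coeff_has_integral:
  assumes p: "1 \<le> p" and u: "Lp_T p u"
  shows "((\<lambda>s. exp (- \<i> * of_int k * complex_of_real s) *\<^sub>C u s) has_integral
    (2 * pi) *\<^sub>R fourier_coeff u k) {0..2*pi}"
  using integrable_integral[OF Lp_T_fourier_integrable[OF p u, of k]]
  by (simp add: fourier_coeff_def scaleR_scaleC scaleC_scaleC scaleC_one)

lemma fourier_coeff_eqI:
  assumes "((\<lambda>s. exp (- \<i> * of_int k * complex_of_real s) *\<^sub>C u s) has_integral (2 * pi) *\<^sub>R J) {0..2*pi}"
  shows "fourier_coeff u k = J"
  unfolding fourier_coeff_def integral_unique[OF assms]
  by (simp add: scaleR_scaleC scaleC_scaleC scaleC_one)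

lemma fourier_coeff_add:
  assumes "1 \<le> p" "Lp_T p u" "Lp_T p v"
  shows "fourier_coeff (u + v) k = fourier_coeff u k + fourier_coeff v k"
  using has_integral_add[OF fourier_coeff_has_integral[OF assms(1,2)] fourier_coeff_has_integral[OF assms(1,3)]]
  by (intro fourier_coeff_eqI) (simp add: scaleC_simps scaleR_add_right)

lemma fourier_coeff_scaleR:
  assumes "1 \<le> p" "Lp_T p u"
  shows "fourier_coeff (c *\<^sub>R u) k = c *\<^sub>R fourier_coeff u k"
  using has_integral_cmul[OF fourier_coeff_has_integral[OF assms], of c]
  by (intro fourier_coeff_eqI) (simp add: scaleR_fun_def scaleC_simps mult.commute)

text \<open>Continuity of each coefficient in the \<open>L\<^sup>p\<close> seminorm, with a constant
  independent of \<open>k\<close>; through it the relation between a function and its derivative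
  survives limits.\<close>

lemma norm_fourier_coeff_le:
  assumes p: "1 \<le> p" and u: "Lp_T p u"
  shows "norm (fourier_coeff u k) \<le> (2 * pi + 1) * Lp_norm p u"
proof -
  have int: "(\<lambda>t. norm (u t)) integrable_on {0..2*pi}"
    using Lp_T_norm_integrable[OF p u] by (intro integrable_on_lebesgue_on) auto
  have "norm ((2 * pi) *\<^sub>R fourier_coeff u k) \<le> integral {0..2*pi} (\<lambda>t. norm (u t))"
    unfolding integral_unique[OF fourier_coeff_has_integral[OF p u], symmetric]
    by (intro integral_norm_bound_integral Lp_T_fourier_integrable[OF p u] int)
       (simp add: norm_scaleC norm_exp_i_real del: mult_minus_left)
  also have "\<dots> = (\<integral>t. norm (u t) \<partial>circle)"
    using Lp_T_norm_integrable[OF p u] by (intro lebesgue_integral_eq_integral[symmetric]) auto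
  also have "\<dots> \<le> (2 * pi + 1) * Lp_norm p u" by (rule L1_norm_le_Lp_norm[OF p u])
  finally have "2 * pi * norm (fourier_coeff u k) \<le> (2 * pi + 1) * Lp_norm p u" by simp
  moreover have "1 * norm (fourier_coeff u k) \<le> 2 * pi * norm (fourier_coeff u k)"
    using pi_ge_two by (intro mult_right_mono) auto
  ultimately show ?thesis by simp
qed

lemma fourier_coeff_cong_AE:
  assumes "AE t in circle. u t = v t"
  shows "fourier_coeff u k = fourier_coeff v k"
proof -
  obtain N where N: "negligible N" "\<And>t. t \<in> {0..2*pi} - N \<Longrightarrow> u t = v t"
    using assms by (subst (asm) AE_lebesgue_on_iff_negligible) auto
  show ?thesis unfolding fourier_coeff_def
    by (subst integral_spike[OF N(1)]) (use N(2) in auto)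
qed

text \<open>Origin of the exponential factors in \<open>Delta\<close>: up to the constant
  \<open>e^{-ikr}\<close>, the integrand is a translate of the integrand for \<open>u\<close>
  itself, and translating a periodic function preserves its integral over a period.\<close>

lemma fourier_translate_has_integral:
  assumes p: "1 \<le> p" and u: "Lp_T p u"
  shows "((\<lambda>s. exp (- \<i> * of_int k * complex_of_real s) *\<^sub>C u (s - r)) has_integral
    (2 * pi) *\<^sub>R (exp (- \<i> * of_int k * complex_of_real r) *\<^sub>C fourier_coeff u k)) {0..2*pi}"
proof -
  define F where "F s = exp (- \<i> * of_int k * complex_of_real s) *\<^sub>C u s" for s
  have "periodic2pi F"
    using u exp_minus_of_int_periodic by (simp add: F_def periodic2pi_def Lp_T_iff)
  from periodic_has_integral_translate[OF this fourier_coeff_has_integral[OF p u, of k, folded F_def], of "- r"]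
  have "((\<lambda>s. F (s - r)) has_integral (2 * pi) *\<^sub>R fourier_coeff u k) {0..2*pi}" by simp
  note has_integral_linear[OF this scaleC.bounded_linear_right[of "exp (- \<i> * of_int k * complex_of_real r)"]]
  moreover have "exp (- \<i> * of_int k * complex_of_real r) *\<^sub>C F (s - r) =
      exp (- \<i> * of_int k * complex_of_real s) *\<^sub>C u (s - r)" for s
    unfolding F_def scaleC_scaleC mult_exp_exp by (simp add: algebra_simps)
  ultimately show ?thesis by (simp add: o_def scaleC.scaleR_right)
qed

lemma exp_of_int_has_integral:
  "((\<lambda>s. exp (\<i> * of_int j * complex_of_real s)) has_integral (if j = 0 then 2 * pi else 0)) {0..2*pi}"
proof (cases "j = 0")
  case True
  then show ?thesis using has_integral_const_real[of "1::complex" 0 "2*pi"] by (simp add: scaleR_conv_of_real)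
next
  case False
  define G where "G s = exp (\<i> * of_int j * complex_of_real s) / (\<i> * of_int j)" for s
  have "((\<lambda>s. exp (\<i> * of_int j * complex_of_real s)) has_integral (G (2*pi) - G 0)) {0..2*pi}"
  proof (rule fundamental_theorem_of_calculus)
    show "(G has_vector_derivative exp (\<i> * of_int j * complex_of_real s)) (at s within {0..2*pi})" for s
    proof -
      have "((\<lambda>z. exp (\<i> * of_int j * z) / (\<i> * of_int j)) has_field_derivative
          exp (\<i> * of_int j * complex_of_real s)) (at (complex_of_real s))"
        using False by (auto intro!: derivative_eq_intros)
      then show ?thesis unfolding G_def by (rule has_vector_derivative_real_field)
    qed
  qed simp
  moreover have "G (2*pi) = G 0"
    using exp_of_int_periodic[of j 0] by (simp add: G_def)
  ultimately show ?thesis using False by simp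
qed

lemma fourier_coeff_mode: "fourier_coeff (mode m y) k = (if k = m then y else 0)"
proof (rule fourier_coeff_eqI)
  have "exp (- \<i> * of_int k * complex_of_real s) *\<^sub>C mode m y s =
      exp (\<i> * of_int (m - k) * complex_of_real s) *\<^sub>C y" for s
    unfolding mode_def scaleC_scaleC mult_exp_exp by (simp add: left_diff_distrib right_diff_distrib)
  moreover have "complex_of_real (if m - k = 0 then 2 * pi else 0) *\<^sub>C y =
      (2 * pi) *\<^sub>R (if k = m then y else 0)"
    by (simp add: scaleR_scaleC scaleC.zero_left scaleC.zero_right)
  ultimately show "((\<lambda>s. exp (- \<i> * of_int k * complex_of_real s) *\<^sub>C mode m y s) has_integral
    (2 * pi) *\<^sub>R (if k = m then y else 0)) {0..2*pi}"
    using has_integral_linear[OF exp_of_int_has_integral[of "m - k"] scaleC.bounded_linear_left[of y]]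
    unfolding o_def by simp
qed

section \<open>Rademacher averages\<close>

text \<open>A sign pattern is encoded by the set \<open>J\<close> of indices with sign +1, so that
  averages over signs become finite sums over \<open>Pow I\<close>.\<close>

definition sign_of :: "nat set \<Rightarrow> nat \<Rightarrow> real" where
  "sign_of J l = (if l \<in> J then 1 else -1)"

text \<open>The p-th moment of a Rademacher sum before normalisation: for finite \<open>I\<close>,
  division by the number of subsets of \<open>I\<close> gives the expectation.\<close>

definition sign_sum :: "real \<Rightarrow> nat set \<Rightarrow> (nat \<Rightarrow> 'a::real_normed_vector) \<Rightarrow> real" where
  "sign_sum p I y = (\<Sum>J\<in>Pow I. norm (\<Sum>l\<in>I. sign_of J l *\<^sub>R y l) powr p)"

lemma sum_Pow_insert:
  assumes "finite I" "i \<notin> I"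
  shows "(\<Sum>J\<in>Pow (insert i I). F J) = (\<Sum>J\<in>Pow I. F J + F (insert i J :: 'b set) :: real)"
proof -
  have "inj_on (insert i) (Pow I)"
    using assms by (intro inj_onI) (metis PowD insert_ident subsetD)
  moreover have "Pow I \<inter> insert i ` Pow I = {}" using assms by auto
  ultimately show ?thesis
    unfolding Pow_insert using assms by (subst sum.union_disjoint) (auto simp: sum.reindex sum.distrib)
qed

text \<open>\<open>z + b *\<^sub>R y\<close> is the convex combination of \<open>z - y\<close> and
  \<open>z + y\<close> with weights \<open>(1 - b) / 2\<close> and \<open>(1 + b) / 2\<close>. In
  the sum of the estimates for \<open>b = a\<close> and \<open>b = - a\<close> the weights of each
  endpoint add up to 1.\<close>

lemma norm_powr_pair_mono:
  fixes y z :: "'a::real_normed_vector"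
  assumes p: "1 \<le> p" and a: "\<bar>a\<bar> \<le> 1"
  shows "norm (z - a *\<^sub>R y) powr p + norm (z + a *\<^sub>R y) powr p \<le>
    norm (z - y) powr p + norm (z + y) powr p"
proof -
  have le: "norm (z + b *\<^sub>R y) powr p \<le>
      (1 - (1 + b) / 2) * norm (z - y) powr p + (1 + b) / 2 * norm (z + y) powr p" if b: "\<bar>b\<bar> \<le> 1" for b
  proof -
    have "((1 - b) / 2) *\<^sub>R (z - y) + ((1 + b) / 2) *\<^sub>R (z + y) =
        ((1 - b) / 2 + (1 + b) / 2) *\<^sub>R z + ((1 + b) / 2 - (1 - b) / 2) *\<^sub>R y"
      by (simp only: scaleR_diff_right scaleR_add_right scaleR_add_left scaleR_diff_left) simp
    also have "\<dots> = z + b *\<^sub>R y" by (simp add: diff_divide_distrib[symmetric] add_divide_distrib[symmetric])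
    finally have "z + b *\<^sub>R y = ((1 - b) / 2) *\<^sub>R (z - y) + ((1 + b) / 2) *\<^sub>R (z + y)" ..
    also have "norm \<dots> \<le> (1 - b) / 2 * norm (z - y) + (1 + b) / 2 * norm (z + y)"
      using b by (intro norm_triangle_le) (simp add: abs_le_iff)
    finally have "norm (z + b *\<^sub>R y) powr p \<le> ((1 - (1 + b) / 2) * norm (z - y) + (1 + b) / 2 * norm (z + y)) powr p"
      using p by (intro powr_mono2) (auto simp: field_simps)
    also have "\<dots> \<le> (1 - (1 + b) / 2) * norm (z - y) powr p + (1 + b) / 2 * norm (z + y) powr p"
      using b p by (intro powr_convex_nonneg) (auto simp: abs_le_iff)
    finally show ?thesis .
  qed
  have le': "norm (z - a *\<^sub>R y) powr p \<le>
      (1 - (1 + - a) / 2) * norm (z - y) powr p + (1 + - a) / 2 * norm (z + y) powr p"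
    using le[of "- a"] a by simp
  have "(1 - (1 + - a) / 2) * P + (1 + - a) / 2 * Q + ((1 - (1 + a) / 2) * P + (1 + a) / 2 * Q) = P + Q"
    for P Q :: real by (simp add: field_simps)
  from add_mono[OF le' le[OF a], unfolded this] show ?thesis .
qed

text \<open>The offset \<open>z\<close> makes the induction work: it absorbs the term of the new
  index with either sign, the induction hypothesis removes the other coefficients, and pairing the
  two signs removes \<open>a i\<close>.\<close>

lemma contraction_real:
  fixes y :: "nat \<Rightarrow> 'a::real_normed_vector"
  assumes p: "1 \<le> p" and I: "finite I" and a: "\<And>l. l \<in> I \<Longrightarrow> \<bar>a l\<bar> \<le> 1"
  shows "(\<Sum>J\<in>Pow I. norm (z + (\<Sum>l\<in>I. sign_of J l *\<^sub>R (a l *\<^sub>R y l))) powr p) \<le>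
    (\<Sum>J\<in>Pow I. norm (z + (\<Sum>l\<in>I. sign_of J l *\<^sub>R y l)) powr p)"
  using I a
proof (induction I arbitrary: z rule: finite_induct)
  case (insert i I)
  \<comment> \<open>Subsets without \<open>i\<close> give the new term the sign -1, their
    counterparts \<open>insert i J\<close> give it the sign +1.\<close>
  have step: "(\<Sum>J\<in>Pow (insert i I). norm (z + (\<Sum>l\<in>insert i I. sign_of J l *\<^sub>R w l)) powr p) =
      (\<Sum>J\<in>Pow I. norm ((z - w i) + (\<Sum>l\<in>I. sign_of J l *\<^sub>R w l)) powr p +
                  norm ((z + w i) + (\<Sum>l\<in>I. sign_of J l *\<^sub>R w l)) powr p)" for w :: "nat \<Rightarrow> 'a" and z
  proof -
    have "(\<Sum>l\<in>I. sign_of (Set.insert i J) l *\<^sub>R w l) = (\<Sum>l\<in>I. sign_of J l *\<^sub>R w l)" for J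
      using insert.hyps by (intro sum.cong) (auto simp: sign_of_def)
    moreover have "sign_of J i = -1" if "J \<in> Pow I" for J
      using that insert.hyps by (auto simp: sign_of_def)
    moreover have "sign_of (Set.insert i J) i = 1" for J by (simp add: sign_of_def)
    ultimately show ?thesis
      using insert.hyps by (subst sum_Pow_insert) (auto intro!: sum.cong simp: algebra_simps)
  qed
  let ?S = "\<lambda>J. \<Sum>l\<in>I. sign_of J l *\<^sub>R y l" and ?w = "\<lambda>l. a l *\<^sub>R y l"
  have "(\<Sum>J\<in>Pow (insert i I). norm (z + (\<Sum>l\<in>insert i I. sign_of J l *\<^sub>R ?w l)) powr p) =
      (\<Sum>J\<in>Pow I. norm ((z - ?w i) + (\<Sum>l\<in>I. sign_of J l *\<^sub>R ?w l)) powr p) +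
      (\<Sum>J\<in>Pow I. norm ((z + ?w i) + (\<Sum>l\<in>I. sign_of J l *\<^sub>R ?w l)) powr p)"
    unfolding step sum.distrib ..
  also have "\<dots> \<le> (\<Sum>J\<in>Pow I. norm ((z - ?w i) + ?S J) powr p) + (\<Sum>J\<in>Pow I. norm ((z + ?w i) + ?S J) powr p)"
    using insert.prems by (intro add_mono insert.IH) auto
  also have "\<dots> = (\<Sum>J\<in>Pow I. norm ((z + ?S J) - a i *\<^sub>R y i) powr p + norm ((z + ?S J) + a i *\<^sub>R y i) powr p)"
    unfolding sum.distrib by (simp add: algebra_simps)
  also have "\<dots> \<le> (\<Sum>J\<in>Pow I. norm ((z + ?S J) - y i) powr p + norm ((z + ?S J) + y i) powr p)"
    using insert.prems by (intro sum_mono norm_powr_pair_mono p) auto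
  also have "\<dots> = (\<Sum>J\<in>Pow (insert i I). norm (z + (\<Sum>l\<in>insert i I. sign_of J l *\<^sub>R y l)) powr p)"
    unfolding step by (simp add: algebra_simps)
  finally show ?case .
qed simp

text \<open>The real contraction principle is applied to the real and imaginary parts of the
  coefficients; recombining them by convexity costs the factor \<open>2 powr p\<close>, that is 2 at
  the level of norms.\<close>

lemma Kahane_contraction:
  fixes y :: "nat \<Rightarrow> 'a::cbanach"
  assumes p: "1 \<le> p" and I: "finite I" and a: "\<And>l. l \<in> I \<Longrightarrow> cmod (a l) \<le> 1"
  shows "sign_sum p I (\<lambda>l. a l *\<^sub>C y l) \<le> 2 powr p * sign_sum p I y"
proof -
  have half: "(s + t) powr p \<le> 2 powr p * ((s powr p + t powr p) / 2)" if "0 \<le> s" "0 \<le> t" for s t :: real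
  proof -
    have "(s + t) powr p = 2 powr p * ((1 - 1/2) * s + 1/2 * t) powr p"
      using that by (simp add: powr_mult[symmetric] algebra_simps)
    also have "\<dots> \<le> 2 powr p * ((1 - 1/2) * s powr p + 1/2 * t powr p)"
      using that p by (intro mult_left_mono powr_convex_nonneg) auto
    finally show ?thesis by (simp add: field_simps)
  qed
  let ?S = "\<lambda>c J. \<Sum>l\<in>I. sign_of J l *\<^sub>R (c l *\<^sub>R y l)"
  have split: "norm (\<Sum>l\<in>I. sign_of J l *\<^sub>R (a l *\<^sub>C y l)) powr p \<le>
     2 powr p * ((norm (?S (\<lambda>l. Re (a l)) J) powr p + norm (?S (\<lambda>l. Im (a l)) J) powr p) / 2)" for J
  proof -
    have "a l *\<^sub>C y l = Re (a l) *\<^sub>R y l + \<i> *\<^sub>C (Im (a l) *\<^sub>R y l)" for l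
      by (simp add: scaleR_scaleC scaleC_scaleC scaleC_add_left[symmetric] complex_eq[symmetric])
    then have "(\<Sum>l\<in>I. sign_of J l *\<^sub>R (a l *\<^sub>C y l)) = ?S (\<lambda>l. Re (a l)) J + \<i> *\<^sub>C ?S (\<lambda>l. Im (a l)) J"
      by (simp add: scaleR_add_right sum.distrib scaleC.sum_right scaleC.scaleR_right)
    then have "norm (\<Sum>l\<in>I. sign_of J l *\<^sub>R (a l *\<^sub>C y l)) \<le>
        norm (?S (\<lambda>l. Re (a l)) J) + norm (?S (\<lambda>l. Im (a l)) J)"
      using norm_triangle_ineq[of "?S (\<lambda>l. Re (a l)) J" "\<i> *\<^sub>C ?S (\<lambda>l. Im (a l)) J"]
      by (simp add: norm_scaleC)
    then have "norm (\<Sum>l\<in>I. sign_of J l *\<^sub>R (a l *\<^sub>C y l)) powr p \<le>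
        (norm (?S (\<lambda>l. Re (a l)) J) + norm (?S (\<lambda>l. Im (a l)) J)) powr p"
      using p by (intro powr_mono2) auto
    also have "\<dots> \<le> 2 powr p * ((norm (?S (\<lambda>l. Re (a l)) J) powr p + norm (?S (\<lambda>l. Im (a l)) J) powr p) / 2)"
      by (rule half) auto
    finally show ?thesis .
  qed
  have re: "(\<Sum>J\<in>Pow I. norm (?S c J) powr p) \<le> sign_sum p I y" if "\<And>l. l \<in> I \<Longrightarrow> \<bar>c l\<bar> \<le> 1" for c
    using contraction_real[OF p I that, where z = 0 and y = y] by (simp add: sign_sum_def)
  have "sign_sum p I (\<lambda>l. a l *\<^sub>C y l) \<le> (\<Sum>J\<in>Pow I. 2 powr p *
      ((norm (?S (\<lambda>l. Re (a l)) J) powr p + norm (?S (\<lambda>l. Im (a l)) J) powr p) / 2))"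
    unfolding sign_sum_def by (intro sum_mono split)
  also have "\<dots> = 2 powr p * (((\<Sum>J\<in>Pow I. norm (?S (\<lambda>l. Re (a l)) J) powr p) +
      (\<Sum>J\<in>Pow I. norm (?S (\<lambda>l. Im (a l)) J) powr p)) / 2)"
    by (simp only: sum_distrib_left[symmetric] sum_divide_distrib[symmetric] sum.distrib)
  also have "\<dots> \<le> 2 powr p * ((sign_sum p I y + sign_sum p I y) / 2)"
    using a by (intro mult_left_mono divide_right_mono add_mono re)
      (auto intro: order.trans[OF abs_Re_le_cmod] order.trans[OF abs_Im_le_cmod])
  finally show ?thesis by simp
qed

lemma prob_space_unit_interval: "prob_space unit_interval_measure"
  unfolding unit_interval_measure_def
  by (rule prob_spaceI) (simp add: emeasure_restrict_space)

lemma space_unit_interval: "space unit_interval_measure = {0..1}"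
  by (simp add: unit_interval_measure_def space_restrict_space)

text \<open>By independence each of the \<open>2 ^ m\<close> sign patterns has probability
  \<open>(1/2) ^ m\<close>, so the integral of a function of the pattern is a uniform
  average.\<close>

lemma rademacher_integral:
  fixes F :: "nat set \<Rightarrow> real"
  assumes rv: "rademacher_family rv m"
  shows "(\<integral>t. F {l\<in>{1..m}. rv l t = 1} \<partial>unit_interval_measure) = (\<Sum>J\<in>Pow {1..m}. F J) / 2 ^ m"
proof -
  let ?U = unit_interval_measure
  interpret prob_space ?U by (rule prob_space_unit_interval)
  define E where "E J = {t\<in>{0..1::real}. {l\<in>{1..m}. rv l t = 1} = J}" for J
  have ind: "indep_vars (\<lambda>_. borel) rv {1..m}"
    and val: "\<And>l t. l \<in> {1..m} \<Longrightarrow> t \<in> {0..1} \<Longrightarrow> rv l t \<in> {-1, 1}"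
    and half: "\<And>l. l \<in> {1..m} \<Longrightarrow> prob {t\<in>{0..1}. rv l t = 1} = 1/2"
      "\<And>l. l \<in> {1..m} \<Longrightarrow> prob {t\<in>{0..1}. rv l t = -1} = 1/2"
    using rv by (auto simp: rademacher_family_def)
  have meas: "rv l \<in> borel_measurable ?U" if "l \<in> {1..m}" for l
    using ind that by (auto simp: indep_vars_def2)
  have E: "E J \<in> sets ?U \<and> prob (E J) = (1/2) ^ m" if J: "J \<in> Pow {1..m}" for J
  \<comment> \<open>Without indices the intersection below would be the whole line instead of the
    unit interval, and the product rule for independent variables asks for a nonempty index
    set.\<close>
  proof (cases "m = 0")
    case True
    then have "E J = space ?U" using J by (auto simp: E_def space_unit_interval)
    then show ?thesis using True prob_space by simp
  next
    case False
    have one: "rv l -` {sign_of J l} \<inter> space ?U = {t\<in>{0..1}. rv l t = sign_of J l}" for l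
      by (auto simp: space_unit_interval)
    have eq: "E J = (\<Inter>l\<in>{1..m}. rv l -` {sign_of J l} \<inter> space ?U)"
    proof (rule set_eqI)
      fix t
      show "t \<in> E J \<longleftrightarrow> t \<in> (\<Inter>l\<in>{1..m}. rv l -` {sign_of J l} \<inter> space ?U)"
      proof (cases "t \<in> {0..1}")
        case True
        have "t \<in> E J \<longleftrightarrow> (\<forall>l\<in>{1..m}. rv l t = 1 \<longleftrightarrow> l \<in> J)"
          using True J unfolding E_def by blast
        also have "\<dots> \<longleftrightarrow> (\<forall>l\<in>{1..m}. rv l t = sign_of J l)"
        proof (intro ball_cong refl)
          fix l assume "l \<in> {1..m}"
          then have "rv l t = -1 \<or> rv l t = 1" using val[OF _ True] by blast
          then show "(rv l t = 1 \<longleftrightarrow> l \<in> J) \<longleftrightarrow> rv l t = sign_of J l" by (auto simp: sign_of_def)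
        qed
        finally show ?thesis unfolding one using True False by auto
      next
        case f: False
        have "1 \<in> {1..m}" using False by simp
        then show ?thesis using f unfolding one E_def by blast
      qed
    qed
    have "prob (E J) = (\<Prod>l\<in>{1..m}. prob (rv l -` {sign_of J l} \<inter> space ?U))"
      unfolding eq by (rule indep_varsD[OF ind]) (use False in auto)
    also have "\<dots> = (\<Prod>l\<in>{1..m}. 1/2)"
      unfolding one by (intro prod.cong refl) (use half in \<open>simp add: sign_of_def\<close>)
    finally have "prob (E J) = (1/2) ^ m" by simp
    moreover have "E J \<in> sets ?U"
      unfolding eq using False by (intro sets.finite_INT measurable_sets[OF meas]) auto
    ultimately show ?thesis by blast
  qed
  have "F {l\<in>{1..m}. rv l t = 1} = (\<Sum>J\<in>Pow {1..m}. F J * indicator (E J) t)" if "t \<in> space ?U" for t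
  proof -
    have *: "(\<Sum>J\<in>Pow {1..m}. F J * indicator (E J) t) =
        (\<Sum>J\<in>{{l\<in>{1..m}. rv l t = 1}}. F J * indicator (E J) t)"
      by (rule sum.mono_neutral_right) (auto simp: E_def indicator_def)
    have "t \<in> E {l\<in>{1..m}. rv l t = 1}" using that unfolding E_def space_unit_interval by blast
    then show ?thesis unfolding * by simp
  qed
  then have "(\<integral>t. F {l\<in>{1..m}. rv l t = 1} \<partial>?U) = (\<integral>t. (\<Sum>J\<in>Pow {1..m}. F J * indicator (E J) t) \<partial>?U)"
    by (intro Bochner_Integration.integral_cong refl)
  also have "\<dots> = (\<Sum>J\<in>Pow {1..m}. F J * prob (E J))"
    using E by (subst Bochner_Integration.integral_sum) (auto simp: emeasure_eq_measure)
  also have "\<dots> = (\<Sum>J\<in>Pow {1..m}. F J * (1/2) ^ m)" using E by (intro sum.cong) auto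
  finally show ?thesis by (simp add: sum_divide_distrib power_one_over)
qed

text \<open>Only the joint law of the signs enters, so the right-hand side does not mention
  \<open>rv\<close>, and R-boundedness turns into an inequality between finite sums.\<close>

lemma Lp01_norm_rademacher:
  assumes rv: "rademacher_family rv m"
  shows "Lp01_norm p (\<lambda>t. \<Sum>l=1..m. rv l t *\<^sub>R y l) = (sign_sum p {1..m} y / 2 ^ m) powr (1 / p)"
proof -
  have "rv l t = sign_of {l\<in>{1..m}. rv l t = 1} l" if "l \<in> {1..m}" "t \<in> {0..1}" for l t
  proof -
    have "rv l t = -1 \<or> rv l t = 1" using rv that unfolding rademacher_family_def by blast
    then show ?thesis using that by (auto simp: sign_of_def)
  qed
  then have "(\<integral>t. norm (\<Sum>l=1..m. rv l t *\<^sub>R y l) powr p \<partial>unit_interval_measure) =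
     (\<integral>t. norm (\<Sum>l=1..m. sign_of {l\<in>{1..m}. rv l t = 1} l *\<^sub>R y l) powr p \<partial>unit_interval_measure)"
    by (intro Bochner_Integration.integral_cong refl arg_cong[where f = "\<lambda>x. norm x powr p"] sum.cong)
       (simp add: space_unit_interval)
  then show ?thesis
    unfolding Lp01_norm_def sign_sum_def
    using rademacher_integral[OF rv, of "\<lambda>J. norm (\<Sum>l=1..m. sign_of J l *\<^sub>R y l) powr p"] by simp
qed

section \<open>The delay equation\<close>

lemma Lp_T_complete:
  fixes u :: "nat \<Rightarrow> real \<Rightarrow> 'a::banach"
  assumes p: "1 \<le> p" and u: "\<And>j. Lp_T p (u j)" and sum: "summable (\<lambda>j. Lp_norm p (u j))"
  obtains s where "Lp_T p s" and "AE t in lebesgue. (\<lambda>n. (\<Sum>j<n. u j) t) \<longlonglongrightarrow> s t"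
    and "(\<lambda>n. Lp_norm p (s - (\<Sum>j<n. u j))) \<longlonglongrightarrow> 0" and "Lp_norm p s \<le> (\<Sum>j. Lp_norm p (u j))"
proof -
  obtain s where s: "Lp_T p s" "AE t in lebesgue. (\<lambda>j. u j t) sums s t"
    "\<And>n. Lp_norm p (s - (\<Sum>j<n. u j)) \<le> (\<Sum>j. Lp_norm p (u (j + n)))"
    using Riesz_Fischer[OF p u sum] by blast
  have 1: "AE t in lebesgue. (\<lambda>n. (\<Sum>j<n. u j) t) \<longlonglongrightarrow> s t"
    using s(2) by (simp add: sum_fun_apply sums_def)
  have 2: "(\<lambda>n. Lp_norm p (s - (\<Sum>j<n. u j))) \<longlonglongrightarrow> 0"
    by (rule tendsto_sandwich[OF _ _ tendsto_const suminf_exist_split2[OF sum]])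
       (use s(3) in \<open>auto simp: Lp_norm_nonneg\<close>)
  have 3: "Lp_norm p s \<le> (\<Sum>j. Lp_norm p (u j))" using s(3)[of 0] by simp
  show ?thesis by (rule that[OF s(1) 1 2 3])
qed

lemma Lp_norm_cong_AE:
  assumes "AE t in circle. u t = v t"
    and "u measurable_on {0..2*pi}" "v measurable_on {0..2*pi}"
  shows "Lp_norm p u = Lp_norm p v"
  unfolding Lp_norm_def
proof (rule arg_cong[where f = "\<lambda>x. x powr (1/p)"], rule integral_cong_AE)
  note [measurable] = measurable_on_norm_circle[OF assms(2)] measurable_on_norm_circle[OF assms(3)]
  show "(\<lambda>t. norm (u t) powr p) \<in> borel_measurable circle" "(\<lambda>t. norm (v t) powr p) \<in> borel_measurable circle"
    by measurable
  show "AE t in circle. norm (u t) powr p = norm (v t) powr p" using assms(1) by eventually_elim simp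
qed

lemma Lp_T_cong_AE:
  assumes u: "Lp_T p u" and v: "periodic2pi v" and eq: "AE t in circle. u t = v t"
  shows "Lp_T p v"
proof -
  obtain N where N: "negligible N" "\<And>t. t \<in> {0..2*pi} - N \<Longrightarrow> v t = u t"
    using eq by (subst (asm) AE_lebesgue_on_iff_negligible) auto
  have meas: "v measurable_on {0..2*pi}"
    using u by (intro measurable_on_spike[OF _ N]) (auto simp: Lp_T_iff)
  have "integrable circle (\<lambda>t. norm (v t) powr p)"
  proof (rule integrable_cong_AE_imp)
    show "integrable circle (\<lambda>t. norm (u t) powr p)" using u by (simp add: Lp_T_iff)
    show "(\<lambda>t. norm (v t) powr p) \<in> borel_measurable circle"
      using measurable_on_norm_circle[OF meas] by measurable
    show "AE t in circle. norm (u t) powr p = norm (v t) powr p" using eq by eventually_elim simp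
  qed
  then show ?thesis using v meas by (simp add: Lp_T_iff)
qed

lemma Lp_norm_eq_0_AE:
  assumes p: "1 \<le> p" and u: "Lp_T p u" and 0: "Lp_norm p u = 0"
  shows "AE t in circle. u t = 0"
proof -
  have "(\<integral>t. norm (u t) powr p \<partial>circle) = 0"
    using Lp_norm_powr[of p u] p 0 by simp
  then have "AE t in circle. norm (u t) powr p = 0"
    using u by (subst (asm) integral_nonneg_eq_0_iff_AE) (auto simp: Lp_T_iff)
  then show ?thesis by eventually_elim simp
qed

lemma Lp_T_diff: "1 \<le> p \<Longrightarrow> Lp_T p u \<Longrightarrow> Lp_T p v \<Longrightarrow> Lp_T p (u - v)"
  using subspace_diff[OF subspace_Lp_T, of p u v] by simp

text \<open>Identifies a prescribed limit in the seminorm with the limit constructed almost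
  everywhere.\<close>

lemma Lp_limit_unique_AE:
  assumes p: "1 \<le> p" and f: "Lp_T p f" and g: "Lp_T p g" and s: "\<And>n. Lp_T p (s n)"
    and "(\<lambda>n. Lp_norm p (f - s n)) \<longlonglongrightarrow> 0" "(\<lambda>n. Lp_norm p (g - s n)) \<longlonglongrightarrow> 0"
  shows "AE t in lebesgue. f t = g t"
proof -
  have "Lp_norm p (f - g) \<le> Lp_norm p (f - s n) + Lp_norm p (g - s n)" for n
  proof -
    have "Lp_norm p ((f - s n) + (-1) *\<^sub>R (g - s n)) \<le> Lp_norm p (f - s n) + Lp_norm p ((-1) *\<^sub>R (g - s n))"
      by (intro Lp_norm_triangle Lp_T_scaleR Lp_T_diff p f g s)
    moreover have "Lp_norm p ((-1) *\<^sub>R (g - s n)) = Lp_norm p (g - s n)"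
      using p by (subst Lp_norm_scaleR) auto
    moreover have "(f - s n) + (-1) *\<^sub>R (g - s n) = f - g" by (simp only: scaleR_minus1_left) simp
    ultimately show ?thesis by simp
  qed
  then have "Lp_norm p (f - g) \<le> 0 + 0"
    by (intro tendsto_lowerbound[OF tendsto_add[OF assms(5,6)]] always_eventually) auto
  then have "Lp_norm p (f - g) = 0" using Lp_norm_nonneg[of p "f - g"] by simp
  then have "AE t in circle. (f - g) t = 0"
    using Lp_norm_eq_0_AE[OF p Lp_T_diff[OF p f g]] by blast
  then have "AE t in circle. f t = g t" by simp
  then show ?thesis
    by (rule AE_circle_imp_AE_lebesgue[rotated]) (use f g in \<open>simp add: Lp_T_iff periodic2pi_def\<close>)
qed

lemma fourier_coeff_tendsto:
  assumes p: "1 \<le> p" and s: "Lp_T p s" and u: "\<And>n. Lp_T p (u n)"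
    and lim: "(\<lambda>n. Lp_norm p (s - u n)) \<longlonglongrightarrow> 0"
  shows "(\<lambda>n. fourier_coeff (u n) k) \<longlonglongrightarrow> fourier_coeff s k"
proof -
  have "norm (fourier_coeff s k - fourier_coeff (u n) k) \<le> (2 * pi + 1) * Lp_norm p (s - u n)" for n
  proof -
    have "fourier_coeff s k = fourier_coeff (u n + (s - u n)) k" by simp
    also have "\<dots> = fourier_coeff (u n) k + fourier_coeff (s - u n) k"
      by (intro fourier_coeff_add[OF p] u Lp_T_diff p s)
    finally show ?thesis using norm_fourier_coeff_le[OF p Lp_T_diff[OF p s u[of n]], of k] by simp
  qed
  then have "(\<lambda>n. fourier_coeff s k - fourier_coeff (u n) k) \<longlonglongrightarrow> 0"
    by (intro Lim_null_comparison[OF always_eventually tendsto_mult_right_zero[OF lim]]) auto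
  from tendsto_diff[OF tendsto_const[of "fourier_coeff s k"] this] show ?thesis by simp
qed

text \<open>The derivative, existentially quantified in \<open>periodic_strong_solution\<close>, is
  a component here so that it can be estimated.\<close>

definition solution_graph where
  "solution_graph p D A B n r = {(f, x, v). Lp_T p f \<and> H1p_deriv p x v \<and> (\<forall>t. x t \<in> D) \<and>
     (AE t in lebesgue. v t = A (x t) + (\<Sum>j=1..n. B (x (t - r j))) + f t)}"

locale delay_equation =
  fixes D :: "'a::cbanach set" and A B :: "'a \<Rightarrow> 'a"
    and n :: nat and r :: "nat \<Rightarrow> real" and p :: real
  assumes A: "closed_linear_operator D A" and B: "cbounded_linear B" and p: "1 \<le> p"
begin

abbreviation graph where "graph \<equiv> solution_graph p D A B n r"

lemma D_0: "0 \<in> D" and D_add: "x \<in> D \<Longrightarrow> y \<in> D \<Longrightarrow> x + y \<in> D"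
  and D_scaleC: "x \<in> D \<Longrightarrow> c *\<^sub>C x \<in> D" and D_scaleR: "x \<in> D \<Longrightarrow> a *\<^sub>R x \<in> D"
  and A_add: "x \<in> D \<Longrightarrow> y \<in> D \<Longrightarrow> A (x + y) = A x + A y"
  and A_scaleC: "x \<in> D \<Longrightarrow> A (c *\<^sub>C x) = c *\<^sub>C A x"
  and A_scaleR: "x \<in> D \<Longrightarrow> A (a *\<^sub>R x) = a *\<^sub>R A x"
  using A by (auto simp: closed_linear_operator_def scaleR_scaleC)

lemma A_0: "A 0 = 0"
  using A_scaleC[OF D_0, of 0] by (simp add: scaleC_simps)

lemma B_bounded_linear: "bounded_linear B" and B_scaleC: "B (c *\<^sub>C x) = c *\<^sub>C B x"
  using B by (auto simp: cbounded_linear_def)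

lemmas B_linear = linear_add[OF bounded_linear.linear[OF B_bounded_linear]]
  linear_scale[OF bounded_linear.linear[OF B_bounded_linear]]
  linear_0[OF bounded_linear.linear[OF B_bounded_linear]]

lemma graph_D:
  assumes "(f, x, v) \<in> graph"
  shows "Lp_T p f" "Lp_T p x" "Lp_T p v" "x t \<in> D"
    "fourier_coeff v k = (\<i> * of_int k) *\<^sub>C fourier_coeff x k"
    "AE t in lebesgue. v t = A (x t) + (\<Sum>j=1..n. B (x (t - r j))) + f t"
  using assms by (auto simp: solution_graph_def H1p_deriv_def)

lemma subspace_graph: "subspace graph"
proof (rule subspaceI)
  have "fourier_coeff (\<lambda>t. 0::'a) k = 0" for k
    by (simp add: fourier_coeff_def scaleC.zero_right)
  then show "0 \<in> graph"
    by (simp add: solution_graph_def zero_prod_def H1p_deriv_def zero_fun_def Lp_T_0 D_0 A_0 B_linear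
      scaleC.zero_right)
next
  fix w w' assume "w \<in> graph" "w' \<in> graph"
  then obtain f x v f' x' v' where w: "w = (f, x, v)" "(f, x, v) \<in> graph"
    and w': "w' = (f', x', v')" "(f', x', v') \<in> graph" by (metis prod_cases3)
  note g = graph_D[OF w(2)] graph_D[OF w'(2)]
  have "AE t in lebesgue. (v + v') t = A ((x + x') t) + (\<Sum>j=1..n. B ((x + x') (t - r j))) + (f + f') t"
    using graph_D(6)[OF w(2)] graph_D(6)[OF w'(2)]
    by eventually_elim (simp add: A_add[OF g(4) g(10)] B_linear sum.distrib)
  then have "(f + f', x + x', v + v') \<in> graph"
    using g by (auto simp: solution_graph_def H1p_deriv_def Lp_T_add[OF p] fourier_coeff_add[OF p]
      scaleC.add_right D_add)
  then show "w + w' \<in> graph" by (simp add: w(1) w'(1))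
next
  fix c w assume "w \<in> graph"
  then obtain f x v where w: "w = (f, x, v)" "(f, x, v) \<in> graph" by (metis prod_cases3)
  note g = graph_D[OF w(2)]
  have "AE t in lebesgue. (c *\<^sub>R v) t = A ((c *\<^sub>R x) t) + (\<Sum>j=1..n. B ((c *\<^sub>R x) (t - r j))) + (c *\<^sub>R f) t"
    using graph_D(6)[OF w(2)]
    by eventually_elim (simp add: scaleR_fun_def A_scaleR[OF g(4)] B_linear scaleR_sum_right scaleR_add_right)
  moreover have "(c *\<^sub>R x) t \<in> D" for t by (simp add: scaleR_fun_def D_scaleR[OF g(4)])
  ultimately have "(c *\<^sub>R f, c *\<^sub>R x, c *\<^sub>R v) \<in> graph"
    using g by (auto simp: solution_graph_def H1p_deriv_def Lp_T_scaleR fourier_coeff_scaleR[OF p]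
      scaleC.scaleR_right)
  then show "c *\<^sub>R w \<in> graph" by (simp add: w(1))
qed

text \<open>The equation is multiplied by \<open>e^{-ikt}\<close> and integrated over a period; the
  delays turn into scalar factors and the closed operator passes through the integral.\<close>

lemma fourier_coeff_solution:
  assumes g: "(f, x, v) \<in> graph"
  shows "fourier_coeff x k \<in> D" "Delta A B n r k (fourier_coeff x k) = fourier_coeff f k"
proof -
  note g = graph_D[OF g]
  define e where "e s = exp (- \<i> * of_int k * complex_of_real s)" for s
  obtain N where N: "negligible N" "\<And>t. t \<notin> N \<Longrightarrow> v t = A (x t) + (\<Sum>j=1..n. B (x (t - r j))) + f t"
    using g(6) unfolding AE_lebesgue_iff_negligible by blast
  have x: "((\<lambda>s. e s *\<^sub>C x s) has_integral (2 * pi) *\<^sub>R fourier_coeff x k) {0..2*pi}"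
    unfolding e_def by (rule fourier_coeff_has_integral[OF p g(2)])
  have v: "((\<lambda>s. e s *\<^sub>C v s) has_integral (2 * pi) *\<^sub>R fourier_coeff v k) {0..2*pi}"
    unfolding e_def by (rule fourier_coeff_has_integral[OF p g(3)])
  have f: "((\<lambda>s. e s *\<^sub>C f s) has_integral (2 * pi) *\<^sub>R fourier_coeff f k) {0..2*pi}"
    unfolding e_def by (rule fourier_coeff_has_integral[OF p g(1)])
  have b: "((\<lambda>s. B (e s *\<^sub>C x (s - r j))) has_integral B ((2 * pi) *\<^sub>R (e (r j) *\<^sub>C fourier_coeff x k))) {0..2*pi}" for j
    using has_integral_linear[OF fourier_translate_has_integral[OF p g(2), of k "r j"] B_bounded_linear]
    by (simp only: o_def e_def)
  \<comment> \<open>All terms of the equation except the one with \<open>A\<close> are known to be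
    integrable. Solving for \<open>A (e s *\<^sub>C x s)\<close> gives the integrability of that
    term as a consequence.\<close>
  have J: "((\<lambda>s. e s *\<^sub>C v s - (\<Sum>j=1..n. B (e s *\<^sub>C x (s - r j))) - e s *\<^sub>C f s) has_integral
     (2 * pi) *\<^sub>R fourier_coeff v k - (\<Sum>j=1..n. B ((2 * pi) *\<^sub>R (e (r j) *\<^sub>C fourier_coeff x k))) -
     (2 * pi) *\<^sub>R fourier_coeff f k) {0..2*pi}"
    by (intro has_integral_diff has_integral_sum v b f) auto
  have "((\<lambda>s. A (e s *\<^sub>C x s)) has_integral
     (2 * pi) *\<^sub>R fourier_coeff v k - (\<Sum>j=1..n. B ((2 * pi) *\<^sub>R (e (r j) *\<^sub>C fourier_coeff x k))) -
     (2 * pi) *\<^sub>R fourier_coeff f k) {0..2*pi}"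
  proof (rule has_integral_spike[OF N(1) _ J])
    fix s assume "s \<in> {0..2*pi} - N"
    then have "v s = A (x s) + (\<Sum>j=1..n. B (x (s - r j))) + f s" using N by blast
    then show "A (e s *\<^sub>C x s) = e s *\<^sub>C v s - (\<Sum>j=1..n. B (e s *\<^sub>C x (s - r j))) - e s *\<^sub>C f s"
      by (simp add: A_scaleC[OF g(4)] B_scaleC scaleC.add_right scaleC.sum_right)
  qed
  from closed_operator_has_integral[OF A _ x this] g(4) D_scaleC
  have 1: "(2 * pi) *\<^sub>R fourier_coeff x k \<in> D" and 2: "A ((2 * pi) *\<^sub>R fourier_coeff x k) =
     (2 * pi) *\<^sub>R fourier_coeff v k - (\<Sum>j=1..n. B ((2 * pi) *\<^sub>R (e (r j) *\<^sub>C fourier_coeff x k))) -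
     (2 * pi) *\<^sub>R fourier_coeff f k" by blast+
  show xD: "fourier_coeff x k \<in> D" using D_scaleR[OF 1, of "inverse (2 * pi)"] by simp
  have "(2 * pi) *\<^sub>R A (fourier_coeff x k) = (2 * pi) *\<^sub>R (fourier_coeff v k -
     (\<Sum>j=1..n. B (e (r j) *\<^sub>C fourier_coeff x k)) - fourier_coeff f k)"
    using 2 unfolding A_scaleR[OF xD] by (simp add: B_linear scaleR_sum_right scaleR_diff_right)
  then have "A (fourier_coeff x k) = fourier_coeff v k -
     (\<Sum>j=1..n. e (r j) *\<^sub>C B (fourier_coeff x k)) - fourier_coeff f k"
    by (simp add: B_scaleC)
  then show "Delta A B n r k (fourier_coeff x k) = fourier_coeff f k"
    by (simp add: Delta_def e_def g(5))
qed

text \<open>Since \<open>e^{ik(t-r)} = e^{ikt} e^{-ikr}\<close>, every term is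
  \<open>e^{ikt}\<close> times a fixed vector, and the equation holds at each
  \<open>t\<close>.\<close>

lemma mode_solution:
  assumes w: "w \<in> D"
  shows "(mode k (Delta A B n r k w), mode k w, mode k ((\<i> * of_int k) *\<^sub>C w)) \<in> graph"
proof -
  define e where "e t = exp (\<i> * of_int k * complex_of_real t)" for t
  have e: "e (t - s) = e t * exp (- \<i> * of_int k * complex_of_real s)" for t s
    unfolding e_def mult_exp_exp by (simp add: algebra_simps)
  have "mode k ((\<i> * of_int k) *\<^sub>C w) t =
      A (mode k w t) + (\<Sum>j=1..n. B (mode k w (t - r j))) + mode k (Delta A B n r k w) t" for t
    unfolding mode_def e_def[symmetric] e Delta_def
    by (simp add: A_scaleC[OF w] B_scaleC scaleC.diff_right scaleC.sum_right scaleC_scaleC)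
  moreover have "mode k w t \<in> D" for t unfolding mode_def by (rule D_scaleC[OF w])
  ultimately show ?thesis
    by (auto simp: solution_graph_def H1p_deriv_def Lp_T_mode[OF p] fourier_coeff_mode scaleC.zero_right)
qed

lemma graph_closed:
  assumes g: "\<And>j. (u j, x j, v j) \<in> graph" and su: "summable (\<lambda>j. Lp_norm p (u j))"
    and sxv: "summable (\<lambda>j. Lp_norm p (x j) + Lp_norm p (v j))"
    and f: "Lp_T p f" "(\<lambda>m. Lp_norm p (f - (\<Sum>j<m. u j))) \<longlonglongrightarrow> 0"
  shows "\<exists>y w. (f, y, w) \<in> graph \<and>
    Lp_norm p y + Lp_norm p w \<le> (\<Sum>j. Lp_norm p (x j) + Lp_norm p (v j))"
proof -
  have sx: "summable (\<lambda>j. Lp_norm p (x j))" and sv: "summable (\<lambda>j. Lp_norm p (v j))"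
    by (rule summable_comparison_test'[OF sxv, of 0]; simp add: Lp_norm_nonneg)+
  note Lp = graph_D[OF g]
  \<comment> \<open>\<open>f\<close> is known only as a limit in the seminorm; \<open>f0\<close> is
    in addition the almost everywhere limit, and the two agree off a null set.\<close>
  obtain f0 where f0: "Lp_T p f0" "AE t in lebesgue. (\<lambda>m. (\<Sum>j<m. u j) t) \<longlonglongrightarrow> f0 t"
    "(\<lambda>m. Lp_norm p (f0 - (\<Sum>j<m. u j))) \<longlonglongrightarrow> 0"
    using Lp_T_complete[OF p Lp(1) su] by blast
  obtain x0 where x0: "Lp_T p x0" "AE t in lebesgue. (\<lambda>m. (\<Sum>j<m. x j) t) \<longlonglongrightarrow> x0 t"
    "(\<lambda>m. Lp_norm p (x0 - (\<Sum>j<m. x j))) \<longlonglongrightarrow> 0" "Lp_norm p x0 \<le> (\<Sum>j. Lp_norm p (x j))"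
    using Lp_T_complete[OF p Lp(2) sx] by blast
  obtain v0 where v0: "Lp_T p v0" "AE t in lebesgue. (\<lambda>m. (\<Sum>j<m. v j) t) \<longlonglongrightarrow> v0 t"
    "(\<lambda>m. Lp_norm p (v0 - (\<Sum>j<m. v j))) \<longlonglongrightarrow> 0" "Lp_norm p v0 \<le> (\<Sum>j. Lp_norm p (v j))"
    using Lp_T_complete[OF p Lp(3) sv] by blast
  define U X W where "U m = (\<Sum>j<m. u j)" and "X m = (\<Sum>j<m. x j)" and "W m = (\<Sum>j<m. v j)" for m
  have G: "(U m, X m, W m) \<in> graph" for m
  proof (induction m)
    case 0
    show ?case
      using subspace_0[OF subspace_graph] unfolding U_def X_def W_def zero_prod_def lessThan_0 sum.empty .
  next
    case (Suc m)
    from subspace_add[OF subspace_graph this g[of m]] show ?case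
      by (simp only: U_def X_def W_def add_Pair sum.lessThan_Suc)
  qed
  have f_eq: "AE t in lebesgue. f t = f0 t"
    using Lp_limit_unique_AE[OF p f(1) f0(1) _ f(2) f0(3)] graph_D(1)[OF G, unfolded U_def] by blast
  \<comment> \<open>Each delay moves the exceptional set of \<open>x0\<close>; even over all indices
    \<open>i\<close> the union of these sets is countable.\<close>
  have shift: "AE t in lebesgue. \<forall>i. (\<lambda>m. X m (t - r i)) \<longlonglongrightarrow> x0 (t - r i)"
    unfolding AE_all_countable X_def using AE_lebesgue_translate[OF x0(2)] by blast
  have eqs: "AE t in lebesgue. \<forall>m. W m t = A (X m t) + (\<Sum>j=1..n. B (X m (t - r j))) + U m t"
    unfolding AE_all_countable using graph_D(6)[OF G] by blast
  have cl: "closed {(x, A x) | x. x \<in> D}" using A by (simp add: closed_linear_operator_def)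
  have main: "AE t in lebesgue. x0 t \<in> D \<and> v0 t = A (x0 t) + (\<Sum>j=1..n. B (x0 (t - r j))) + f t"
    using f_eq shift eqs f0(2) x0(2) v0(2) unfolding U_def[symmetric] X_def[symmetric] W_def[symmetric]
  proof eventually_elim
    case (elim t)
    have "(\<lambda>m. W m t - (\<Sum>j=1..n. B (X m (t - r j))) - U m t) \<longlonglongrightarrow>
        v0 t - (\<Sum>j=1..n. B (x0 (t - r j))) - f0 t"
      using elim by (intro tendsto_diff tendsto_sum bounded_linear.tendsto[OF B_bounded_linear]) auto
    moreover have "W m t - (\<Sum>j=1..n. B (X m (t - r j))) - U m t = A (X m t)" for m
      using elim(3) by simp
    ultimately have "(\<lambda>m. A (X m t)) \<longlonglongrightarrow> v0 t - (\<Sum>j=1..n. B (x0 (t - r j))) - f0 t" by simp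
    with elim(5) have lim: "(\<lambda>m. (X m t, A (X m t))) \<longlonglongrightarrow> (x0 t, v0 t - (\<Sum>j=1..n. B (x0 (t - r j))) - f0 t)"
      by (rule tendsto_Pair)
    have "(X m t, A (X m t)) \<in> {(x, A x) | x. x \<in> D}" for m using graph_D(4)[OF G] by blast
    from closed_sequentially[OF cl this lim]
    have "(x0 t, v0 t - (\<Sum>j=1..n. B (x0 (t - r j))) - f0 t) \<in> {(x, A x) | x. x \<in> D}" .
    then show ?case using elim(1) by (auto simp: algebra_simps)
  qed
  \<comment> \<open>A solution has to lie in \<open>D\<close> at every \<open>t\<close>, not only almost everywhere.\<close>
  define y where "y t = (if x0 t \<in> D then x0 t else 0)" for t
  have y_eq: "AE t in lebesgue. x0 t = y t" using main by eventually_elim (simp add: y_def)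
  have y_eq': "AE t in circle. x0 t = y t" using AE_lebesgue_imp_AE_circle[OF y_eq] .
  have y: "Lp_T p y"
    by (rule Lp_T_cong_AE[OF x0(1) _ y_eq']) (use x0(1) in \<open>simp add: y_def Lp_T_iff periodic2pi_def\<close>)
  have "AE t in lebesgue. \<forall>i. x0 (t - r i) = y (t - r i)"
    unfolding AE_all_countable using AE_lebesgue_translate[OF y_eq] by blast
  then have eq: "AE t in lebesgue. v0 t = A (y t) + (\<Sum>j=1..n. B (y (t - r j))) + f t"
    using main y_eq by eventually_elim simp
  \<comment> \<open>The derivative relation holds for every partial sum, and both sides are
    continuous in the seminorm.\<close>
  have "fourier_coeff v0 k = (\<i> * of_int k) *\<^sub>C fourier_coeff x0 k" for k
  proof (rule LIMSEQ_unique)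
    show "(\<lambda>m. fourier_coeff (W m) k) \<longlonglongrightarrow> fourier_coeff v0 k"
      by (rule fourier_coeff_tendsto[OF p v0(1) graph_D(3)[OF G]]) (use v0(3) in \<open>simp add: W_def\<close>)
    have "(\<lambda>m. fourier_coeff (X m) k) \<longlonglongrightarrow> fourier_coeff x0 k"
      by (rule fourier_coeff_tendsto[OF p x0(1) graph_D(2)[OF G]]) (use x0(3) in \<open>simp add: X_def\<close>)
    then show "(\<lambda>m. fourier_coeff (W m) k) \<longlonglongrightarrow> (\<i> * of_int k) *\<^sub>C fourier_coeff x0 k"
      unfolding graph_D(5)[OF G] by (intro scaleC.tendsto tendsto_const)
  qed
  then have "H1p_deriv p y v0"
    unfolding H1p_deriv_def using y v0(1) fourier_coeff_cong_AE[OF y_eq'] by simp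
  moreover have "y t \<in> D" for t using D_0 by (simp add: y_def)
  ultimately have "(f, y, v0) \<in> graph" using f(1) eq by (simp add: solution_graph_def)
  moreover have "Lp_norm p y = Lp_norm p x0"
    using Lp_norm_cong_AE[OF y_eq'] y x0(1) unfolding Lp_T_iff by metis
  moreover have "(\<Sum>j. Lp_norm p (x j) + Lp_norm p (v j)) = (\<Sum>j. Lp_norm p (x j)) + (\<Sum>j. Lp_norm p (v j))"
    using suminf_add[OF sx sv] by simp
  ultimately show ?thesis using x0(4) v0(4) by (intro exI[of _ y] exI[of _ v0]) simp
qed

section \<open>A uniform estimate for solutions\<close>

lemma a_priori_bound:
  assumes surj: "\<And>f. Lp_T p f \<Longrightarrow> \<exists>x v. (f, x, v) \<in> graph"
  shows "\<exists>C>0. \<forall>f\<in>{f. Lp_T p f}. \<forall>a>0. Lp_norm p f \<le> a \<longrightarrow>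
    (\<exists>w. (f, w) \<in> graph \<and> (case w of (x, v) \<Rightarrow> Lp_norm p x + Lp_norm p v) \<le> C * a)"
proof (rule closed_graph_seminorm[OF subspace_Lp_T[OF p] subspace_graph])
  have p0: "p > 0" using p by simp
  show "fst ` graph = {f. Lp_T p f}"
  proof
    show "fst ` graph \<subseteq> {f. Lp_T p f}" using graph_D(1) by auto
    show "{f. Lp_T p f} \<subseteq> fst ` graph" using surj by force
  qed
  show "Lp_norm p (c *\<^sub>R f) = \<bar>c\<bar> * Lp_norm p f" for c and f :: "real \<Rightarrow> 'a"
    by (rule Lp_norm_scaleR[OF p0])
  show "Lp_norm p (f + g) \<le> Lp_norm p f + Lp_norm p g" if "f \<in> {f. Lp_T p f}" "g \<in> {f. Lp_T p f}"
    for f g :: "real \<Rightarrow> 'a" using that by (intro Lp_norm_triangle[OF p]) auto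
  show "(case c *\<^sub>R w of (x, v) \<Rightarrow> Lp_norm p x + Lp_norm p v) =
     \<bar>c\<bar> * (case w of (x, v) \<Rightarrow> Lp_norm p x + Lp_norm p v)" for c and w :: "(real \<Rightarrow> 'a) \<times> (real \<Rightarrow> 'a)"
    by (cases w) (simp add: Lp_norm_scaleR[OF p0] distrib_left)
  show "(case w + z of (x, v) \<Rightarrow> Lp_norm p x + Lp_norm p v) \<le>
     (case w of (x, v) \<Rightarrow> Lp_norm p x + Lp_norm p v) + (case z of (x, v) \<Rightarrow> Lp_norm p x + Lp_norm p v)"
    if w: "w \<in> snd ` graph" and z: "z \<in> snd ` graph" for w z
  proof -
    obtain f x v where w: "w = (x, v)" "(f, x, v) \<in> graph" using w by auto
    obtain g y u where z: "z = (y, u)" "(g, y, u) \<in> graph" using z by auto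
    have "Lp_norm p (x + y) \<le> Lp_norm p x + Lp_norm p y" "Lp_norm p (v + u) \<le> Lp_norm p v + Lp_norm p u"
      by (intro Lp_norm_triangle[OF p] graph_D(2,3)[OF w(2)] graph_D(2,3)[OF z(2)])+
    then show ?thesis by (simp add: w(1) z(1))
  qed
  show "\<exists>f\<in>{f. Lp_T p f}. (\<lambda>n. Lp_norm p (f - (\<Sum>j<n. u j))) \<longlonglongrightarrow> 0"
    if "\<And>j. u j \<in> {f. Lp_T p f}" "summable (\<lambda>j. Lp_norm p (u j))" for u :: "nat \<Rightarrow> real \<Rightarrow> 'a"
    using Lp_T_complete[OF p _ that(2)] that(1) by blast
  show "\<exists>z. (f, z) \<in> graph \<and> (case z of (x, v) \<Rightarrow> Lp_norm p x + Lp_norm p v) \<le>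
      (\<Sum>j. case w j of (x, v) \<Rightarrow> Lp_norm p x + Lp_norm p v)"
    if "\<And>j. (u j, w j) \<in> graph" "summable (\<lambda>j. Lp_norm p (u j))"
      "summable (\<lambda>j. case w j of (x, v) \<Rightarrow> Lp_norm p x + Lp_norm p v)" "f \<in> {f. Lp_T p f}"
      "(\<lambda>n. Lp_norm p (f - (\<Sum>j<n. u j))) \<longlonglongrightarrow> 0" for u w f
    using graph_closed[of u "\<lambda>j. fst (w j)" "\<lambda>j. snd (w j)" f] that by (auto simp: case_prod_beta)
qed

text \<open>The closed graph argument yields one well bounded solution. Uniqueness transfers its
  bound to every solution, and the equation then forces the derivatives to agree almost everywhere
  as well.\<close>

lemma solution_bound:
  assumes surj: "\<And>f. Lp_T p f \<Longrightarrow> \<exists>x v. (f, x, v) \<in> graph"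
    and unique: "\<And>f x v y w. (f, x, v) \<in> graph \<Longrightarrow> (f, y, w) \<in> graph \<Longrightarrow> AE t in lebesgue. x t = y t"
  shows "\<exists>C>0. \<forall>f x v. (f, x, v) \<in> graph \<longrightarrow> Lp_norm p x + Lp_norm p v \<le> C * Lp_norm p f"
proof -
  obtain C where C: "C > 0" and bound: "\<And>f a. Lp_T p f \<Longrightarrow> a > 0 \<Longrightarrow> Lp_norm p f \<le> a \<Longrightarrow>
    \<exists>x v. (f, x, v) \<in> graph \<and> Lp_norm p x + Lp_norm p v \<le> C * a"
    using a_priori_bound[OF surj] by auto
  have "Lp_norm p x + Lp_norm p v \<le> C * Lp_norm p f" if g: "(f, x, v) \<in> graph" for f x v
  proof (rule field_le_epsilon)
    fix e :: real assume e: "e > 0"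
    \<comment> \<open>The bound needs a positive level, so \<open>e / C\<close> is added to the norm
      of \<open>f\<close>, which may be zero; it contributes exactly \<open>e\<close>.\<close>
    obtain y w where yw: "(f, y, w) \<in> graph" "Lp_norm p y + Lp_norm p w \<le> C * (Lp_norm p f + e / C)"
      using bound[OF graph_D(1)[OF g], of "Lp_norm p f + e / C"] C e Lp_norm_nonneg[of p f]
      by (auto simp: add_nonneg_pos)
    have xy: "AE t in lebesgue. x t = y t" using unique[OF g yw(1)] .
    have "AE t in lebesgue. \<forall>i. x (t - r i) = y (t - r i)"
      unfolding AE_all_countable using AE_lebesgue_translate[OF xy] by blast
    then have vw: "AE t in lebesgue. v t = w t"
      using xy graph_D(6)[OF g] graph_D(6)[OF yw(1)] by eventually_elim simp
    have "Lp_norm p x = Lp_norm p y" "Lp_norm p v = Lp_norm p w"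
      using Lp_norm_cong_AE[OF AE_lebesgue_imp_AE_circle[OF xy]]
        Lp_norm_cong_AE[OF AE_lebesgue_imp_AE_circle[OF vw]] graph_D(2,3)[OF g] graph_D(2,3)[OF yw(1)]
      unfolding Lp_T_iff by metis+
    then show "Lp_norm p x + Lp_norm p v \<le> C * Lp_norm p f + e"
      using yw(2) C by (simp add: distrib_left)
  qed
  then show ?thesis using C by blast
qed

section \<open>The inverses and their R-bound\<close>

lemma bounded_inverse_Delta:
  assumes surj: "\<And>f. Lp_T p f \<Longrightarrow> \<exists>x v. (f, x, v) \<in> graph"
    and bound: "\<And>f x v. (f, x, v) \<in> graph \<Longrightarrow> Lp_norm p x + Lp_norm p v \<le> C * Lp_norm p f"
  shows "\<exists>R. bounded_inverse D (Delta A B n r k) R"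
proof -
  let ?\<Delta> = "Delta A B n r k"
  have \<Delta>_add: "?\<Delta> (x + y) = ?\<Delta> x + ?\<Delta> y" if "x \<in> D" "y \<in> D" for x y
    using that by (simp add: Delta_def A_add B_linear scaleC.add_right sum.distrib)
  have \<Delta>_scaleC: "?\<Delta> (c *\<^sub>C x) = c *\<^sub>C ?\<Delta> x" if "x \<in> D" for c x
    using that by (simp add: Delta_def A_scaleC B_scaleC scaleC.diff_right scaleC.sum_right scaleC_scaleC mult.commute)
  \<comment> \<open>The same factor \<open>(2 * pi) powr (1 / p)\<close> appears for
    \<open>w\<close> and for its image under \<open>?\<Delta>\<close>, so it cancels and
    \<open>C\<close> itself bounds the inverse.\<close>
  have norm_mode: "Lp_norm p (mode k y) = (2 * pi) powr (1 / p) * norm y" for y :: 'a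
    using p by (simp add: Lp_norm_def norm_mode measure_restrict_space powr_mult powr_powr)
  have ex: "\<exists>w\<in>D. ?\<Delta> w = y" for y
  proof -
    obtain x v where "(mode k y, x, v) \<in> graph" using surj[OF Lp_T_mode[OF p]] by blast
    from fourier_coeff_solution[OF this, of k] show ?thesis by (auto simp: fourier_coeff_mode)
  qed
  have le: "norm w \<le> C * norm (?\<Delta> w)" if "w \<in> D" for w
  proof -
    have "Lp_norm p (mode k w) \<le> C * Lp_norm p (mode k (?\<Delta> w))"
      using bound[OF mode_solution[OF that, of k]] Lp_norm_nonneg[of p "mode k ((\<i> * of_int k) *\<^sub>C w)"] by linarith
    then show ?thesis unfolding norm_mode by (simp add: mult.left_commute)
  qed
  have inj: "w = z" if "w \<in> D" "z \<in> D" "?\<Delta> w = ?\<Delta> z" for w z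
  proof -
    have mz: "(-1) *\<^sub>C z \<in> D" using D_scaleC that by blast
    have "?\<Delta> (w + (-1) *\<^sub>C z) = 0"
      using that \<Delta>_add[OF that(1) mz] \<Delta>_scaleC[OF that(2), of "-1"]
      by (simp add: scaleC.minus_left scaleC_one)
    then have "norm (w + (-1) *\<^sub>C z) \<le> 0" using le[OF D_add[OF that(1) mz]] by simp
    then show ?thesis by (simp add: scaleC.minus_left scaleC_one)
  qed
  define R where "R y = (THE w. w \<in> D \<and> ?\<Delta> w = y)" for y
  have R: "R y \<in> D \<and> ?\<Delta> (R y) = y" for y
    unfolding R_def by (rule theI') (use ex inj in blast)
  have R_\<Delta>: "R (?\<Delta> w) = w" if "w \<in> D" for w using inj R that by blast
  have R_add: "R (y + z) = R y + R z" for y z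
    using R_\<Delta>[of "R y + R z"] \<Delta>_add[of "R y" "R z"] R D_add by simp
  have R_scaleC: "R (c *\<^sub>C y) = c *\<^sub>C R y" for c y
    using R_\<Delta>[of "c *\<^sub>C R y"] \<Delta>_scaleC[of "R y" c] R D_scaleC by simp
  have "bounded_linear R"
  proof (rule bounded_linear_intro)
    show "R (y + z) = R y + R z" for y z by (rule R_add)
    show "R (c *\<^sub>R y) = c *\<^sub>R R y" for c y by (simp add: scaleR_scaleC R_scaleC)
    show "norm (R y) \<le> norm y * C" for y using le[of "R y"] R by (simp add: mult.commute)
  qed
  then have "bounded_inverse D ?\<Delta> R"
    using R R_\<Delta> R_scaleC by (simp add: bounded_inverse_def cbounded_linear_def)
  then show ?thesis by blast
qed

text \<open>The R-bound \<open>4 * C\<close> is \<open>2 * C * 2\<close>: one factor 2 for inserting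
  the exponentials into the sum of the \<open>x l\<close>, one for removing them from the sum of the
  images, and \<open>C\<close> from the equation in between.\<close>

lemma R_bounded_multiplier:
  assumes R: "\<And>k. bounded_inverse D (Delta A B n r k) (R k)" and C: "C > 0"
    and bound: "\<And>f x v. (f, x, v) \<in> graph \<Longrightarrow> Lp_norm p v \<le> C * Lp_norm p f"
  shows "R_bounded (range (\<lambda>k y. (\<i> * of_int k) *\<^sub>C R k y))"
proof -
  have p0: "p > 0" using p by simp
  have main: "sign_sum p {1..m} (\<lambda>l. (\<i> * of_int (k l)) *\<^sub>C R (k l) (x l)) \<le> (4 * C) powr p * sign_sum p {1..m} x"
    for m and k :: "nat \<Rightarrow> int" and x
  proof -
    define y where "y l = (\<i> * of_int (k l)) *\<^sub>C R (k l) (x l)" for l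
    define S where "S z J = (\<Sum>l=1..m. sign_of J l *\<^sub>R mode (k l) (z l))" for z :: "nat \<Rightarrow> 'a" and J
    have S_apply: "S z J t = (\<Sum>l=1..m. sign_of J l *\<^sub>R mode (k l) (z l) t)" for z J t
      unfolding S_def sum_fun_apply by (simp add: scaleR_fun_def)
    \<comment> \<open>A signed sum of mode solutions is again a solution, so the estimate applies to
      the whole sum, with \<open>C\<close> independent of \<open>m\<close>, the frequencies and the
      signs.\<close>
    have "(\<Sum>l=1..m. sign_of J l *\<^sub>R (mode (k l) (x l), mode (k l) (R (k l) (x l)), mode (k l) (y l))) \<in> graph" for J
    proof (intro subspace_sum[OF subspace_graph] subspace_scale[OF subspace_graph])
      fix l
      have "R (k l) (x l) \<in> D" "Delta A B n r (k l) (R (k l) (x l)) = x l"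
        using R[of "k l"] by (auto simp: bounded_inverse_def)
      then show "(mode (k l) (x l), mode (k l) (R (k l) (x l)), mode (k l) (y l)) \<in> graph"
        using mode_solution[of "R (k l) (x l)" "k l"] by (simp add: y_def)
    qed
    then have G: "(S x J, S (\<lambda>l. R (k l) (x l)) J, S y J) \<in> graph" for J
      by (simp add: S_def scaleR_Pair sum_prod)
    have Lp: "integrable circle (\<lambda>t. norm (S z J t) powr p)" for z J
      using Lp_T_sum[OF p Lp_T_scaleR[OF Lp_T_mode[OF p]]] unfolding S_def Lp_T_iff by blast
    have mult: "(\<integral>t. norm (S y J t) powr p \<partial>circle) \<le> C powr p * (\<integral>t. norm (S x J t) powr p \<partial>circle)" for J
    proof -
      have "Lp_norm p (S y J) powr p \<le> (C * Lp_norm p (S x J)) powr p"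
        using bound[OF G] p by (intro powr_mono2) (auto simp: Lp_norm_nonneg)
      then show ?thesis using C by (simp add: powr_mult Lp_norm_nonneg Lp_norm_powr[OF p0])
    qed
    have sgn: "sign_sum p {1..m} (\<lambda>l. mode (k l) (z l) t) = (\<Sum>J\<in>Pow {1..m}. norm (S z J t) powr p)" for z t
      unfolding sign_sum_def S_apply ..
    have int: "integrable circle (\<lambda>t. sign_sum p {1..m} (\<lambda>l. mode (k l) (z l) t))" for z :: "nat \<Rightarrow> 'a"
      unfolding sgn by (intro Bochner_Integration.integrable_sum Lp)
    have const: "(\<integral>t. c \<partial>circle) = 2 * pi * c" "integrable circle (\<lambda>t. c)" for c :: real
      using finite_measure.integrable_const[OF finite_measure_lebesgue_on_Icc]
      by (auto simp: measure_restrict_space)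
    \<comment> \<open>At a fixed \<open>t\<close> the exponentials are scalars of modulus 1, and so
      are their inverses; hence the contraction principle works in both directions.\<close>
    have up: "sign_sum p {1..m} (\<lambda>l. mode (k l) (x l) t) \<le> 2 powr p * sign_sum p {1..m} x" for t
      unfolding mode_def by (rule Kahane_contraction[OF p]) (auto simp: norm_exp_i_real)
    have down: "sign_sum p {1..m} y \<le> 2 powr p * sign_sum p {1..m} (\<lambda>l. mode (k l) (y l) t)" for t
    proof -
      have "exp (- \<i> * of_int (k l) * complex_of_real t) *\<^sub>C mode (k l) (y l) t = y l" for l
        unfolding mode_def scaleC_scaleC mult_exp_exp by (simp add: scaleC_one)
      then show ?thesis
        using Kahane_contraction[OF p, of "{1..m}" "\<lambda>l. exp (- \<i> * of_int (k l) * complex_of_real t)"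
          "\<lambda>l. mode (k l) (y l) t"] norm_exp_i_real(2) by (simp del: mult_minus_left)
    qed
    \<comment> \<open>The left side does not depend on \<open>t\<close> and is averaged over the
      circle only to reach the norms in the estimate; the factor \<open>2 * pi\<close> reappears at
      the end and cancels.\<close>
    have "2 * pi * sign_sum p {1..m} y = (\<integral>t. sign_sum p {1..m} y \<partial>circle)" by (simp only: const)
    also have "\<dots> \<le> (\<integral>t. 2 powr p * sign_sum p {1..m} (\<lambda>l. mode (k l) (y l) t) \<partial>circle)"
      by (intro integral_mono const integrable_mult_right int down)
    also have "\<dots> = 2 powr p * (\<Sum>J\<in>Pow {1..m}. \<integral>t. norm (S y J t) powr p \<partial>circle)"
      unfolding sgn using Lp by simp
    also have "\<dots> \<le> 2 powr p * (\<Sum>J\<in>Pow {1..m}. C powr p * (\<integral>t. norm (S x J t) powr p \<partial>circle))"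
      by (intro mult_left_mono sum_mono mult) auto
    also have "\<dots> = 2 powr p * C powr p * (\<integral>t. sign_sum p {1..m} (\<lambda>l. mode (k l) (x l) t) \<partial>circle)"
      unfolding sgn using Lp by (simp add: sum_distrib_left mult.assoc)
    also have "\<dots> \<le> 2 powr p * C powr p * (\<integral>t. 2 powr p * sign_sum p {1..m} x \<partial>circle)"
      by (intro mult_left_mono integral_mono const int up) auto
    also have "\<dots> = 2 * pi * ((2 powr p * 2 powr p * C powr p) * sign_sum p {1..m} x)"
      by (simp only: const) (simp add: algebra_simps)
    also have "2 powr p * 2 powr p * C powr p = (4 * C) powr p"
      using C by (simp add: powr_mult[symmetric])
    finally show ?thesis unfolding y_def by simp
  qed
  show ?thesis
    unfolding R_bounded_def
  proof (rule exI[of _ "4 * C"], intro conjI exI[of _ p] allI impI)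
    fix m T rv and x :: "nat \<Rightarrow> 'a"
    assume rv: "rademacher_family rv m" and T: "\<forall>l\<in>{1..m}. T l \<in> range (\<lambda>k y. (\<i> * of_int k) *\<^sub>C R k y)"
    \<comment> \<open>\<open>k\<close> is merely a choice of frequencies on \<open>{1..m}\<close>;
      repetitions are allowed.\<close>
    obtain k where k: "\<And>l. l \<in> {1..m} \<Longrightarrow> T l = (\<lambda>y. (\<i> * of_int (k l)) *\<^sub>C R (k l) y)"
      using bchoice[OF T[unfolded image_iff bex_UNIV]] by blast
    have "sign_sum p {1..m} (\<lambda>l. T l (x l)) = sign_sum p {1..m} (\<lambda>l. (\<i> * of_int (k l)) *\<^sub>C R (k l) (x l))"
      unfolding sign_sum_def using k by (intro sum.cong refl arg_cong[where f = "\<lambda>x. norm x powr p"]) simp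
    then have "sign_sum p {1..m} (\<lambda>l. T l (x l)) \<le> (4 * C) powr p * sign_sum p {1..m} x" using main by simp
    then have "(sign_sum p {1..m} (\<lambda>l. T l (x l)) / 2 ^ m) powr (1 / p) \<le>
       ((4 * C) powr p * (sign_sum p {1..m} x / 2 ^ m)) powr (1 / p)"
      using p by (intro powr_mono2) (auto simp: sign_sum_def sum_nonneg divide_right_mono)
    also have "\<dots> = 4 * C * (sign_sum p {1..m} x / 2 ^ m) powr (1 / p)"
      using C p by (subst powr_mult) (auto simp: powr_powr sign_sum_def sum_nonneg)
    finally show "Lp01_norm p (\<lambda>t. \<Sum>l=1..m. rv l t *\<^sub>R T l (x l)) \<le>
       4 * C * Lp01_norm p (\<lambda>t. \<Sum>l=1..m. rv l t *\<^sub>R x l)"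
      unfolding Lp01_norm_rademacher[OF rv] .
  qed (use C p in auto)
qed

end

theorem theorem3p7:
  fixes D :: "'a::cbanach set" and A B :: "'a \<Rightarrow> 'a"
    and n :: nat and r :: "nat \<Rightarrow> real" and p :: real
  assumes A: "closed_linear_operator D A"
    and B: "cbounded_linear B"
    and r: "\<forall>j\<in>{1..n}. r j \<ge> 0"
    and p: "1 \<le> p"
    and wellposed: "\<forall>f. Lp_T p f \<longrightarrow>
        (\<exists>x. periodic_strong_solution p D A B n r f x) \<and>
        (\<forall>x y. periodic_strong_solution p D A B n r f x \<longrightarrow>
               periodic_strong_solution p D A B n r f y \<longrightarrow>
               (AE t in lebesgue. x t = y t))"
  shows "\<exists>R::int \<Rightarrow> 'a \<Rightarrow> 'a.
           (\<forall>k. bounded_inverse D (Delta A B n r k) (R k)) \<and>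
           R_bounded (range (\<lambda>k y. (\<i> * of_int k) *\<^sub>C R k y))"
proof -
  interpret delay_equation D A B n r p by standard (fact A B p)+
  have surj: "\<exists>x v. (f, x, v) \<in> graph" if "Lp_T p f" for f
    using wellposed that by (auto simp: solution_graph_def periodic_strong_solution_def)
  have sol: "periodic_strong_solution p D A B n r f x" if "(f, x, v) \<in> graph" for f x v
    using that by (auto simp: solution_graph_def periodic_strong_solution_def)
  have unique: "AE t in lebesgue. x t = y t" if "(f, x, v) \<in> graph" "(f, y, w) \<in> graph" for f x v y w
    using wellposed graph_D(1)[OF that(1)] sol[OF that(1)] sol[OF that(2)] by blast
  have "\<exists>C>0. \<forall>f x v. (f, x, v) \<in> graph \<longrightarrow> Lp_norm p x + Lp_norm p v \<le> C * Lp_norm p f"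
    by (rule solution_bound) (use surj unique in blast)+
  then obtain C where C: "C > 0"
    and bound: "\<And>f x v. (f, x, v) \<in> graph \<Longrightarrow> Lp_norm p x + Lp_norm p v \<le> C * Lp_norm p f"
    by blast
  \<comment> \<open>A two-sided inverse is determined by \<open>k\<close>, so the choice only
    collects the inverses into one function.\<close>
  obtain R where R: "\<And>k. bounded_inverse D (Delta A B n r k) (R k)"
    using choice[of "\<lambda>k R. bounded_inverse D (Delta A B n r k) R"] bounded_inverse_Delta[OF surj bound] by blast
  have "Lp_norm p v \<le> C * Lp_norm p f" if "(f, x, v) \<in> graph" for f x v
    using bound[OF that] Lp_norm_nonneg[of p x] by linarith
  then have "R_bounded (range (\<lambda>k y. (\<i> * of_int k) *\<^sub>C R k y))"
    by (rule R_bounded_multiplier[OF R C])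
  then show ?thesis using R by blast
qed

end
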